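(* Let $0\le m\le n$ be integers, let $A$ be an $n$-qubit space and $\delta\in\mathbb R$. For a $\delta$-almost dual universal$_2$ random hash function $F:\{0,1\}^n\to\{0,1\}^m$ and for a sub-normalized state $\rho_{Z^AE}=\sum_z|z\rangle\langle z|_A\otimes\rho^z_E$, $${\rm E}_F\,Q^{{\rm PA},F}(\rho_{Z^AE})\le 2^{m-H_{\rm min}(Z^A|E)_\rho}\,\delta.$$
   Context: All Hilbert spaces are finite-dimensional; logarithms are base 2 (with $2^{-\infty}=0$). A sub-normalized state is a positive semidefinite operator of trace at most 1; $\{|z\rangle\}_{z\in\{0,1\}^n}$ is the computational basis of $A=(\mathbb C^2)^{\otimes n}$. Duality: linear surjective $f:\{0,1\}^n\to\{0,1\}^m$, $g:\{0,1\}^n\to\{0,1\}^{n-m}$, given by full-rank matrices over $\mathbb F_2$ of sizes $m\times n$ and $(n-m)\times n$, are dual ($f\perp g$) if $fg^T=0$. A random function $F$ is a random variable with values in a finite set of functions, and ${\rm E}_F\,r(F)=\sum_f\Pr[F=f]\,r(f)$. Random functions $F,G$ are dual ($G=F^\perp$) if they are chosen from sets $\{f_1,f_2,\dots\}$ and $\{g_1,g_2,\dots\}$ of the same size with $f_i\perp g_i$ and $\Pr[F=f_i]=\Pr[G=g_i]$ for all $i$. A linear random function $G:\{0,1\}^n\to\{0,1\}^{l}$ is $\delta$-almost universal$_2$ if $\Pr[G(x)=0]\le2^{-l}\delta$ for all $x\ne0$. A random function $F:\{0,1\}^n\to\{0,1\}^m$ is $\delta$-almost dual universal$_2$ if its dual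 random function $F^\perp:\{0,1\}^n\to\{0,1\}^{n-m}$ is $\delta$-almost universal$_2$, i.e. $\Pr[F^\perp(x)=0]\le2^{-(n-m)}\delta$ for all $x\ne0$. For linear $f:\{0,1\}^n\to\{0,1\}^m$, $\rho^f_{KE}=\sum_{k\in\{0,1\}^m}|k\rangle\langle k|_K\otimes\sum_{z\in f^{-1}(k)}\rho^z_E$. $H_{\rm max}(K|E)_\rho=\max_{\sigma_E\ge0,{\rm Tr}\sigma=1}\log\big(2^m\,\|\sqrt{\rho_{KE}}\sqrt{2^{-m}I_K\otimes\sigma_E}\|_1^2\big)$, and the privacy amplification index is $Q^{{\rm PA},f}(\rho_{Z^AE})={\rm Tr}(\rho_{Z^AE})-2^{H_{\rm max}(K|E)_{\rho^f}-m}$. $H_{\rm min}(Z^A|E)_\rho=-\log\min\{{\rm Tr}(\sigma):\sigma_E\ge0,\ \rho_{Z^AE}\le I_A\otimes\sigma_E\}$.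
   Formalization: For n = 0 it is additionally assumed that δ ≥ 0: there almost universality is vacuous, so every real δ qualifies, and the claim reads 0 ≤ Tr(ρ)δ, which is false for δ < 0 and ρ ≠ 0. *)

theory Defs
  imports
    "HOL-Probability.Probability_Mass_Function"
    "HOL-Library.Z2"
    "Jordan_Normal_Form.Schur_Decomposition"
    "Jordan_Normal_Form.DL_Rank"
begin

(* HOL-Analysis also uses the infix $ (components of fixed-length vectors); here it is the
   indexing of Jordan_Normal_Form vectors. *)
unbundle no vec_syntax
notation vec_index (infixl \<open>$\<close> 100)

text \<open>
  Operators on a \<open>d\<close>-dimensional Hilbert space are complex \<open>d \<times> d\<close> matrices, bit strings of
  length \<open>n\<close> are the vectors in \<open>carrier_vec n :: bit vec set\<close> over the field with two elements,
  and linear functions between them are bit matrices.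
\<close>

section \<open>Operators\<close>

(* The order on complex numbers is that of HOL-Library.Complex_Order, so the inequality says
   that the expectation value is real and nonnegative; over the complex numbers this already
   makes A Hermitian. The order (\<le>) on matrices in the library is entrywise and is not the
   operator order. *)
definition psd :: "nat \<Rightarrow> complex mat \<Rightarrow> bool" where
  "psd d A \<longleftrightarrow> A \<in> carrier_mat d d \<and> (\<forall>v \<in> carrier_vec d. 0 \<le> (A *\<^sub>v v) \<bullet>c v)"

definition loewner_le :: "nat \<Rightarrow> complex mat \<Rightarrow> complex mat \<Rightarrow> bool" where
  "loewner_le d A B \<longleftrightarrow> A \<in> carrier_mat d d \<and> B \<in> carrier_mat d d \<and> psd d (B - A)"

definition tr :: "complex mat \<Rightarrow> real" where
  "tr A = Re (\<Sum>i<dim_row A. A $$ (i, i))"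

(* Meaningful for positive semidefinite A only, for which B exists and is unique. *)
definition op_sqrt :: "complex mat \<Rightarrow> complex mat" where
  "op_sqrt A = (THE B. psd (dim_row A) B \<and> B * B = A)"

definition trace_norm :: "complex mat \<Rightarrow> real" where
  "trace_norm X = tr (op_sqrt (mat_adjoint X * X))"

definition tensor_op :: "complex mat \<Rightarrow> complex mat \<Rightarrow> complex mat" where
  "tensor_op A B = mat (dim_row A * dim_row B) (dim_col A * dim_col B)
     (\<lambda>(i, j). A $$ (i div dim_row B, j div dim_col B) * B $$ (i mod dim_row B, j mod dim_col B))"

(* The library type of matrices has no neutral element for addition, hence no sum over sets. *)
definition op_sum :: "nat \<Rightarrow> ('i \<Rightarrow> complex mat) \<Rightarrow> 'i set \<Rightarrow> complex mat" where
  "op_sum d X S = mat d d (\<lambda>ij. \<Sum>x\<in>S. X x $$ ij)"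

definition subnormalized_state :: "nat \<Rightarrow> complex mat \<Rightarrow> bool" where
  "subnormalized_state d R \<longleftrightarrow> psd d R \<and> tr R \<le> 1"

definition normalized_state :: "nat \<Rightarrow> complex mat \<Rightarrow> bool" where
  "normalized_state d R \<longleftrightarrow> psd d R \<and> tr R = 1"

section \<open>Classical-quantum states\<close>

(* Position of the basis vector |z> = |z_1> \<otimes> ... \<otimes> |z_n> in the standard basis, for the
   tensor ordering fixed by tensor_op: z is read as a binary number, first bit most significant. *)
definition basis_index :: "bit vec \<Rightarrow> nat" where
  "basis_index z = (\<Sum>i<dim_vec z. if z $ i = 1 then 2 ^ (dim_vec z - 1 - i) else 0)"

(* The projection |z><z| on the space of dim_vec z qubits. *)
definition basis_proj :: "bit vec \<Rightarrow> complex mat" where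
  "basis_proj z = mat (2 ^ dim_vec z) (2 ^ dim_vec z)
     (\<lambda>(i, j). if i = basis_index z \<and> j = basis_index z then 1 else 0)"

definition cq_state :: "nat \<Rightarrow> nat \<Rightarrow> (bit vec \<Rightarrow> complex mat) \<Rightarrow> complex mat" where
  "cq_state n d \<rho> = op_sum (2 ^ n * d) (\<lambda>z. tensor_op (basis_proj z) (\<rho> z)) (carrier_vec n)"

(* The blocks of the state of KE after hashing with f: the sum of \<rho> z over the preimage of k. *)
definition hashed :: "nat \<Rightarrow> nat \<Rightarrow> bit mat \<Rightarrow> (bit vec \<Rightarrow> complex mat) \<Rightarrow> bit vec \<Rightarrow> complex mat" where
  "hashed n d f \<rho> k = op_sum d \<rho> {z \<in> carrier_vec n. f *\<^sub>v z = k}"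

section \<open>Entropies\<close>

definition elog2 :: "real \<Rightarrow> ereal" where
  "elog2 x = (if x \<le> 0 then - \<infinity> else ereal (log 2 x))"

(* The value at \<infinity> is arbitrary; the exponents H_max - m and m - H_min below are never \<infinity>. *)
definition exp2 :: "ereal \<Rightarrow> real" where
  "exp2 x = (if x = - \<infinity> then 0 else 2 powr real_of_ereal x)"

(* R is an operator on an m-qubit space tensored with a d-dimensional space. The supremum is
   attained, as the set of normalized states is compact. *)
definition H_max :: "nat \<Rightarrow> nat \<Rightarrow> complex mat \<Rightarrow> ereal" where
  "H_max m d R = (SUP \<sigma> \<in> {\<sigma>. normalized_state d \<sigma>}.
     elog2 (2 ^ m * (trace_norm (op_sqrt R *
       op_sqrt (tensor_op (complex_of_real (1 / 2 ^ m) \<cdot>\<^sub>m 1\<^sub>m (2 ^ m)) \<sigma>)))\<^sup>2))"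

(* The infimum is attained for positive semidefinite R. For R = 0 it is 0, and H_min is \<infinity>. *)
definition H_min :: "nat \<Rightarrow> nat \<Rightarrow> complex mat \<Rightarrow> ereal" where
  "H_min n d R = - elog2 (Inf (tr `
     {\<sigma>. psd d \<sigma> \<and> loewner_le (2 ^ n * d) R (tensor_op (1\<^sub>m (2 ^ n)) \<sigma>)}))"

definition Q_PA ::
  "nat \<Rightarrow> nat \<Rightarrow> nat \<Rightarrow> (bit vec \<Rightarrow> complex mat) \<Rightarrow> bit mat \<Rightarrow> real" where
  "Q_PA m n d \<rho> f = tr (cq_state n d \<rho>)
     - exp2 (H_max m d (cq_state m d (hashed n d f \<rho>)) - ereal (real m))"

section \<open>Random hash functions\<close>

(* Full-rank m \<times> n matrices, for m \<le> n: the linear surjections from n-bit to m-bit strings. *)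
definition linear_surj :: "nat \<Rightarrow> nat \<Rightarrow> bit mat set" where
  "linear_surj m n = {f \<in> carrier_mat m n. vec_space.rank m f = m}"

definition dual_fun :: "nat \<Rightarrow> nat \<Rightarrow> bit mat \<Rightarrow> bit mat \<Rightarrow> bool" where
  "dual_fun m n f g \<longleftrightarrow> f \<in> linear_surj m n \<and> g \<in> linear_surj (n - m) n
     \<and> f * transpose_mat g = 0\<^sub>m m (n - m)"

(* A random function is given by its distribution; h pairs f_i with g_i. *)
definition dual_random :: "nat \<Rightarrow> nat \<Rightarrow> bit mat pmf \<Rightarrow> bit mat pmf \<Rightarrow> bool" where
  "dual_random m n F G \<longleftrightarrow> (\<exists>h. bij_betw h (set_pmf F) (set_pmf G)
     \<and> (\<forall>f \<in> set_pmf F. dual_fun m n f (h f) \<and> pmf F f = pmf G (h f)))"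

(* The condition on x forces 0 \<le> \<delta> when n > 0 and is vacuous when n = 0. *)
definition almost_universal2 :: "nat \<Rightarrow> nat \<Rightarrow> real \<Rightarrow> bit mat pmf \<Rightarrow> bool" where
  "almost_universal2 n l \<delta> G \<longleftrightarrow> set_pmf G \<subseteq> carrier_mat l n
     \<and> (\<forall>x \<in> carrier_vec n. x \<noteq> 0\<^sub>v n \<longrightarrow>
          measure_pmf.prob G {g. g *\<^sub>v x = 0\<^sub>v l} \<le> 2 powr (- real l) * \<delta>)"

(* The dual G is not unique, but the condition on it depends only on F: g_i x = 0 iff x lies in
   the row space of f_i. *)
definition almost_dual_universal2 :: "nat \<Rightarrow> nat \<Rightarrow> real \<Rightarrow> bit mat pmf \<Rightarrow> bool" where
  "almost_dual_universal2 m n \<delta> F \<longleftrightarrow>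
     (\<exists>G. dual_random m n F G \<and> almost_universal2 n (n - m) \<delta> G)"

end

(* For \<sigma> feasible in H_min and \<epsilon> > 0 put \<rho>_E = sum of the \<rho> z, s = sqrt (\<rho>_E + \<epsilon> I), V = s^-1, and
   evaluate the fidelity in H_max at the normalisation of s^2. If S is the square root of the second
   argument of the fidelity F = ||sqrt R S||_1, then K = S^-1 sqrt (S R S) S^-1 satisfies
   F = tr (S^2 K), tr R = tr (S^2 K^2) and tr (S^-1 R S^-1 R) >= tr (S^2 K^4), so that
   K (K - 1)^2 (K + 2) >= 0 bounds F from below by the collision term tr (S^-1 R S^-1 R).
   A Fourier transform in z turns the collision term of the hashed state into a sum of nonnegative
   numbers c x over the row space of f, where c 0 is at most the trace of \<rho>. The dual of f vanishes on
   the row space, so the average of the rest is at most 2^-(n-m) \<delta> times the sum of all c x, which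
   by Parseval is 2^n times the sum of tr (V \<rho> z V \<rho> z). As \<rho> z <= \<sigma>, this is at most 2^n tr \<sigma>. *)

theory Submission
  imports Defs "Jordan_Normal_Form.Spectral_Radius"
begin

section \<open>Adjoints\<close>

text \<open>The obstacle is that R and S need not commute. If they do, K is sqrt R divided by S, and
  all the trace relations are identities between moments for the weight S^2. In general only the
  relation for the fourth moment becomes an inequality, and it points in the required direction. The
  polynomial K^4 - 3 K^2 + 2 K is a linear form of the interpolation (second moment)^3 <= (first
  moment)^2 (fourth moment). Its double zero at K = 1 is the ideal case R = S^2. For trace one and a
  collision term of at most 1 + x it yields F >= 1 - x/2, hence F^2 >= 1 - x: the 1/2 cancels the
  factor 2 that squaring brings, so the constant in the theorem is \<delta> itself. One choice of s
  serves both halves: V \<rho>_E V <= I bounds c 0 and, once one of the two factors \<rho> z is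
  replaced by \<sigma>, also the sum of all c x. The shift by \<epsilon> is there because \<rho>_E
  may be singular. All estimates hold for every \<epsilon> and every feasible \<sigma>, so a limit
  and an infimum stand in for attained optima.\<close>

lemma mat_adjoint_carrier [simp]:
  "A \<in> carrier_mat n m \<Longrightarrow> mat_adjoint A \<in> carrier_mat m n"
  by (auto simp: mat_adjoint_def mat_of_rows_def)

lemma mat_adjoint_dim [simp]:
  "dim_row (mat_adjoint A) = dim_col A" "dim_col (mat_adjoint A) = dim_row A"
  by (auto simp: mat_adjoint_def)

lemma index_mat_adjoint [simp]:
  fixes A :: "complex mat"
  shows "i < dim_col A \<Longrightarrow> j < dim_row A \<Longrightarrow> mat_adjoint A $$ (i, j) = cnj (A $$ (j, i))"
  by (auto simp: mat_adjoint_def mat_of_rows_def)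

lemma mat_adjoint_adjoint [simp]: "mat_adjoint (mat_adjoint A) = (A :: complex mat)"
  by (rule eq_matI) auto

lemma mat_adjoint_mult:
  fixes A B :: "complex mat"
  assumes "A \<in> carrier_mat n k" "B \<in> carrier_mat k m"
  shows "mat_adjoint (A * B) = mat_adjoint B * mat_adjoint A"
  by (rule eq_matI) (use assms in \<open>auto simp: scalar_prod_def mult.commute\<close>)

lemma mat_adjoint_minus:
  fixes A B :: "complex mat"
  assumes "A \<in> carrier_mat n m" "B \<in> carrier_mat n m"
  shows "mat_adjoint (A - B) = mat_adjoint A - mat_adjoint B"
  by (rule eq_matI) (use assms in auto)

lemma mat_adjoint_diag:
  "mat_adjoint (mat_diag n f) = mat_diag n (\<lambda>i. cnj (f i))"
  by (rule eq_matI) (auto simp: mat_diag_def)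

lemma inner_adjoint:
  fixes A :: "complex mat"
  assumes "A \<in> carrier_mat n m" "v \<in> carrier_vec m" "w \<in> carrier_vec n"
  shows "(A *\<^sub>v v) \<bullet>c w = v \<bullet>c (mat_adjoint A *\<^sub>v w)"
proof -
  have "(A *\<^sub>v v) \<bullet>c w = (\<Sum>i<n. \<Sum>j<m. A $$ (i, j) * v $ j * cnj (w $ i))"
    using assms by (auto simp: scalar_prod_def sum_distrib_right atLeast0LessThan intro!: sum.cong)
  also have "\<dots> = (\<Sum>j<m. \<Sum>i<n. A $$ (i, j) * v $ j * cnj (w $ i))"
    by (rule sum.swap)
  also have "\<dots> = v \<bullet>c (mat_adjoint A *\<^sub>v w)"
    using assms by (auto simp: scalar_prod_def sum_distrib_left atLeast0LessThan mult_ac intro!: sum.cong)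
  finally show ?thesis .
qed

section \<open>Trace\<close>

lemma tr_carrier: "A \<in> carrier_mat n n \<Longrightarrow> tr A = (\<Sum>i<n. Re (A $$ (i, i)))"
  by (auto simp: tr_def)

lemma tr_mult:
  assumes "A \<in> carrier_mat n m" "B \<in> carrier_mat m n"
  shows "tr (A * B) = (\<Sum>i<n. \<Sum>j<m. Re (A $$ (i, j) * B $$ (j, i)))"
  using assms by (auto simp: tr_def scalar_prod_def atLeast0LessThan intro!: sum.cong)

lemma tr_mult_comm:
  assumes "A \<in> carrier_mat n m" "B \<in> carrier_mat m n"
  shows "tr (A * B) = tr (B * A)"
  unfolding tr_mult[OF assms] tr_mult[OF assms(2,1)]
  by (subst sum.swap) (simp add: mult.commute)

lemma tr_add: "A \<in> carrier_mat n n \<Longrightarrow> B \<in> carrier_mat n n \<Longrightarrow> tr (A + B) = tr A + tr B"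
  by (auto simp: tr_def sum.distrib)

lemma tr_minus: "A \<in> carrier_mat n n \<Longrightarrow> B \<in> carrier_mat n n \<Longrightarrow> tr (A - B) = tr A - tr B"
  by (auto simp: tr_def sum_subtractf)

lemma tr_smult: "A \<in> carrier_mat n n \<Longrightarrow> tr (complex_of_real c \<cdot>\<^sub>m A) = c * tr A"
  by (auto simp: tr_def sum_distrib_left)

lemma tr_one [simp]: "tr (1\<^sub>m n) = n"
  by (auto simp: tr_def)

lemma tr_adjoint_mult:
  assumes "B \<in> carrier_mat n m"
  shows "tr (mat_adjoint B * B) = (\<Sum>i<m. \<Sum>j<n. (cmod (B $$ (j, i)))\<^sup>2)"
  using assms
  by (subst tr_mult) (auto simp: cmod_power2 simp flip: power2_eq_square intro!: sum.cong)

text \<open>The trace is the squared Hilbert-Schmidt norm of \<open>B\<close>, a sum of nonnegative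
  terms.\<close>

lemma adjoint_mult_eq_0:
  assumes "B \<in> carrier_mat n m" "tr (mat_adjoint B * B) = 0"
  shows "B = 0\<^sub>m n m"
proof (rule eq_matI)
  fix i j assume ij: "i < dim_row (0\<^sub>m n m :: complex mat)" "j < dim_col (0\<^sub>m n m :: complex mat)"
  have "\<forall>i\<in>{..<m}. (\<Sum>j<n. (cmod (B $$ (j, i)))\<^sup>2) = 0"
    using assms(2) unfolding tr_adjoint_mult[OF assms(1)]
    by (subst (asm) sum_nonneg_eq_0_iff) (auto intro!: sum_nonneg)
  then have "\<forall>i\<in>{..<n}. (cmod (B $$ (i, j)))\<^sup>2 = 0"
    using ij by (subst (asm) sum_nonneg_eq_0_iff) auto
  then show "B $$ (i, j) = 0\<^sub>m n m $$ (i, j)" using ij by auto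
qed (use assms in auto)

section \<open>Positive semidefinite matrices\<close>

lemma psd_carrier: "psd d A \<Longrightarrow> A \<in> carrier_mat d d"
  by (simp add: psd_def)

lemma psd_congruence:
  assumes "psd d A" "B \<in> carrier_mat d k"
  shows "psd k (mat_adjoint B * A * B)"
  unfolding psd_def
proof safe
  have A: "A \<in> carrier_mat d d" using assms psd_carrier by auto
  then show "mat_adjoint B * A * B \<in> carrier_mat k k" using assms(2)
    by (metis mat_adjoint_carrier mult_carrier_mat)
  fix v :: "complex vec" assume v: "v \<in> carrier_vec k"
  have "(mat_adjoint B * A * B *\<^sub>v v) \<bullet>c v = (mat_adjoint B *\<^sub>v (A *\<^sub>v (B *\<^sub>v v))) \<bullet>c v"
    using A assms(2) v
    by (simp add: assoc_mult_mat_vec[of "mat_adjoint B * A" k d B k] assoc_mult_mat_vec[of "mat_adjoint B" k d A d]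
        mult_carrier_mat[of _ k d])
  also have "\<dots> = (A *\<^sub>v (B *\<^sub>v v)) \<bullet>c (B *\<^sub>v v)"
    by (subst inner_adjoint[of _ k d]) (use A assms(2) v in auto)
  also have "\<dots> \<ge> 0" using assms v by (auto simp: psd_def)
  finally show "0 \<le> (mat_adjoint B * A * B *\<^sub>v v) \<bullet>c v" .
qed

lemma psd_one [simp]: "psd d (1\<^sub>m d)"
  by (auto simp: psd_def)

lemma psd_gram: "B \<in> carrier_mat k d \<Longrightarrow> psd d (mat_adjoint B * B)"
  using psd_congruence[OF psd_one, of B k d] by simp

lemma psd_add:
  assumes "psd d A" "psd d B" shows "psd d (A + B)"
  using assms unfolding psd_def
  by (auto simp: add_mult_distrib_mat_vec[of _ d d] add_scalar_prod_distrib[of _ d])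

lemma smult_mat_mult_vec:
  fixes A :: "'a :: comm_ring mat"
  assumes "A \<in> carrier_mat n m" "v \<in> carrier_vec m"
  shows "(c \<cdot>\<^sub>m A) *\<^sub>v v = c \<cdot>\<^sub>v (A *\<^sub>v v)"
  by (rule eq_vecI) (use assms in auto)

lemma psd_smult:
  assumes "psd d A" "0 \<le> c" shows "psd d (complex_of_real c \<cdot>\<^sub>m A)"
proof -
  have "(complex_of_real c \<cdot>\<^sub>m A *\<^sub>v v) \<bullet>c v = complex_of_real c * ((A *\<^sub>v v) \<bullet>c v)"
    if "v \<in> carrier_vec d" for v
    using that psd_carrier[OF assms(1)]
    by (subst smult_mat_mult_vec[of _ d d]) auto
  then show ?thesis using assms
    by (auto simp: psd_def less_eq_complex_def)
qed

lemma psd_zero [simp]: "psd d (0\<^sub>m d d)"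
proof -
  have "0\<^sub>m d d *\<^sub>v v = (0\<^sub>v d :: complex vec)" if "v \<in> carrier_vec d" for v
    using that by (intro eq_vecI) auto
  then show ?thesis by (auto simp: psd_def)
qed

lemma inner_unit_vec:
  fixes A :: "complex mat"
  assumes "A \<in> carrier_mat d d" "i < d" "j < d"
  shows "(A *\<^sub>v unit_vec d i) \<bullet>c unit_vec d j = A $$ (j, i)"
proof -
  have "conjugate (unit_vec d j) = (unit_vec d j :: complex vec)"
    using assms by (intro eq_vecI) (auto simp: unit_vec_def)
  moreover have "A *\<^sub>v unit_vec d i = col A i"
    using assms by (intro eq_vecI) auto
  ultimately show ?thesis
    using assms by simp
qed

text \<open>Polarisation: the quadratic form is real at \<open>e_i + c e_j\<close>. The choice c = 1
  relates the imaginary parts of the two off-diagonal entries, c = \<i> their real parts.\<close>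

lemma psd_hermitian:
  assumes "psd d A" shows "mat_adjoint A = A"
proof (rule eq_matI)
  have A: "A \<in> carrier_mat d d" using assms psd_carrier by auto
  fix i j assume "i < dim_row A" "j < dim_col A"
  then have ij: "i < d" "j < d" using A by auto
  let ?u = "unit_vec d i :: complex vec" and ?w = "unit_vec d j :: complex vec"
  have q: "Im ((A *\<^sub>v v) \<bullet>c v) = 0" if "v \<in> carrier_vec d" for v
    using assms that by (auto simp: psd_def less_eq_complex_def)
  have *: "(A *\<^sub>v (?u + c \<cdot>\<^sub>v ?w)) \<bullet>c (?u + c \<cdot>\<^sub>v ?w)
    = A $$ (i, i) + cnj c * A $$ (j, i) + c * A $$ (i, j) + c * cnj c * A $$ (j, j)" for c
  proof -
    have "A *\<^sub>v (?u + c \<cdot>\<^sub>v ?w) = A *\<^sub>v ?u + c \<cdot>\<^sub>v (A *\<^sub>v ?w)"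
      using A by (simp add: mult_add_distrib_mat_vec[of _ d d] mult_mat_vec[of _ d d])
    moreover have "conjugate (?u + c \<cdot>\<^sub>v ?w) = conjugate ?u + cnj c \<cdot>\<^sub>v conjugate ?w"
      by (subst conjugate_add_vec[of _ d]) (auto simp: conjugate_smult_vec)
    moreover have "(x + c \<cdot>\<^sub>v y) \<bullet> (x' + c' \<cdot>\<^sub>v y') = x \<bullet> x' + c' * (x \<bullet> y') + c * (y \<bullet> x') + c * c' * (y \<bullet> y')"
      if "x \<in> carrier_vec d" "x' \<in> carrier_vec d" "y \<in> carrier_vec d" "y' \<in> carrier_vec d" 
      for x y x' y' :: "complex vec" and c'
      using that
      by (simp add: add_scalar_prod_distrib[of _ d] scalar_prod_add_distrib[of _ d] algebra_simps)
    ultimately show ?thesis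
      using A ij by (simp add: inner_unit_vec)
  qed
  have d: "Im (A $$ (k, k)) = 0" if "k < d" for k
    using q[of "unit_vec d k"] A that by (simp add: inner_unit_vec)
  have "Im (A $$ (j, i) + A $$ (i, j)) = 0"
    using q[of "?u + 1 \<cdot>\<^sub>v ?w"] *[of 1] ij d by simp
  moreover have "Re (A $$ (i, j)) - Re (A $$ (j, i)) = 0"
    using q[of "?u + \<i> \<cdot>\<^sub>v ?w"] *[of \<i>] ij d by simp
  ultimately have "cnj (A $$ (j, i)) = A $$ (i, j)" by (simp add: complex_eq_iff)
  then show "mat_adjoint A $$ (i, j) = A $$ (i, j)" using A ij by simp
qed (use assms psd_carrier[OF assms] in auto)

lemma psd_diag_nonneg: "psd d A \<Longrightarrow> i < d \<Longrightarrow> 0 \<le> A $$ (i, i)"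
  using inner_unit_vec[of A d i i] unfolding psd_def by (metis unit_vec_carrier)

lemma tr_psd_nonneg: "psd d A \<Longrightarrow> 0 \<le> tr A"
  using psd_diag_nonneg[of d A] by (auto simp: tr_carrier[OF psd_carrier] less_eq_complex_def intro!: sum_nonneg)

section \<open>The spectral theorem and square roots\<close>

text \<open>A Householder reflection, after a phase has made the first entry of the vector real.\<close>

lemma unitary_first_column:
  fixes v :: "complex vec"
  assumes v: "v \<in> carrier_vec n" "v \<noteq> 0\<^sub>v n"
  shows "\<exists>H c. H \<in> carrier_mat n n \<and> mat_adjoint H = H \<and> H * H = 1\<^sub>m n \<and> c \<noteq> 0 \<and> H *\<^sub>v unit_vec n 0 = c \<cdot>\<^sub>v v"
proof -
  have n: "0 < n" using v by (cases n) auto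
  define N where "N = (\<Sum>i<n. (cmod (v $ i))\<^sup>2)"
  have "N > 0"
  proof -
    obtain i where "i < n" "v $ i \<noteq> 0" using v by (auto simp: vec_eq_iff)
    then show ?thesis unfolding N_def by (intro sum_pos2[of _ i]) auto
  qed
  \<comment> \<open>The phase makes the first entry of \<open>c \<cdot>\<^sub>v v\<close> real, the
    factor \<open>1 / sqrt N\<close> gives it norm 1.\<close>
  define c where "c = (if v $ 0 = 0 then 1 else cnj (v $ 0) / cmod (v $ 0)) / sqrt N"
  have c: "cmod c = 1 / sqrt N" "c \<noteq> 0"
    using \<open>N > 0\<close> by (auto simp: c_def norm_divide)
  define u where "u i = c * v $ i" for i
  have u0: "Im (u 0) = 0"
  proof (cases "v $ 0 = 0")
    case False
    have "u 0 = (v $ 0 * cnj (v $ 0)) / (cmod (v $ 0) * sqrt N)"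
      using False by (simp add: u_def c_def mult_ac)
    also have "\<dots> = complex_of_real ((cmod (v $ 0))\<^sup>2 / (cmod (v $ 0) * sqrt N))"
      by (simp add: complex_norm_square[symmetric])
    finally show ?thesis by simp
  qed (simp add: u_def)
  have u1: "(\<Sum>i<n. (cmod (u i))\<^sup>2) = 1"
    using \<open>N > 0\<close> c by (simp add: u_def norm_mult power_mult_distrib power_divide N_def flip: sum_divide_distrib)
  show ?thesis
  proof (cases "u 0 = 1")
    \<comment> \<open>Here \<open>u\<close> is the first basis vector, so the direction
      \<open>u - e_0\<close> of the reflection would vanish; the identity takes its place.\<close>
    case True
    have "(\<Sum>i<n. (cmod (u i))\<^sup>2) = 1 + (\<Sum>i\<in>{..<n} - {0}. (cmod (u i))\<^sup>2)"
      using True n by (subst sum.remove[of _ 0]) auto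
    then have "\<forall>i\<in>{..<n} - {0}. (cmod (u i))\<^sup>2 = 0"
      using u1 by (subst sum_nonneg_eq_0_iff[symmetric]) auto
    then have "unit_vec n 0 = c \<cdot>\<^sub>v v"
      using True v n by (intro eq_vecI) (auto simp: u_def unit_vec_def)
    then show ?thesis using c v
      by (intro exI[of _ "1\<^sub>m n"] exI[of _ c]) auto
  next
    case False
    define w where "w i = u i - (if i = 0 then 1 else 0)" for i
    define M where "M = (\<Sum>i<n. (cmod (w i))\<^sup>2)"
    have "M > 0" unfolding M_def using False n
      by (intro sum_pos2[of _ 0]) (auto simp: w_def)
    have "M = (\<Sum>i<n. (cmod (u i))\<^sup>2 + (if i = 0 then 1 - 2 * Re (u 0) else 0))"
      unfolding M_def
    proof (intro sum.cong)
      have "(cmod (u 0 - 1))\<^sup>2 = (cmod (u 0))\<^sup>2 + (1 - 2 * Re (u 0))"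
        unfolding cmod_power2 by (simp add: power2_eq_square algebra_simps)
      then show "(cmod (w i))\<^sup>2 = (cmod (u i))\<^sup>2 + (if i = 0 then 1 - 2 * Re (u 0) else 0)" for i
        by (auto simp: w_def)
    qed auto
    then have M: "M = 2 - 2 * Re (u 0)" using u1 n by (simp add: sum.distrib)
    define H where "H = mat n n (\<lambda>(i, j). (if i = j then 1 else 0) - 2 / M * w i * cnj (w j))"
    have H: "H \<in> carrier_mat n n" by (simp add: H_def)
    have adj: "mat_adjoint H = H" by (rule eq_matI) (auto simp: H_def)
    have Mc: "(\<Sum>i<n. w i * cnj (w i)) = complex_of_real M"
      by (simp add: M_def complex_norm_square[symmetric] del: of_real_power flip: of_real_sum)
    have "H * H = 1\<^sub>m n"
    proof (rule eq_matI)
      fix i j assume "i < dim_row (1\<^sub>m n :: complex mat)" "j < dim_col (1\<^sub>m n :: complex mat)"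
      then have ij: "i < n" "j < n" by auto
      define a where "a = complex_of_real (2 / M)"
      have "(H * H) $$ (i, j) = (\<Sum>k<n. ((if i = k then 1 else 0) - a * w i * cnj (w k))
          * ((if k = j then 1 else 0) - a * w k * cnj (w j)))"
        using ij by (simp add: H_def scalar_prod_def atLeast0LessThan a_def)
      also have "\<dots> = (\<Sum>k<n. (if k = i then (if i = j then 1 else 0) - a * w k * cnj (w j) else 0)
          - (if k = j then a * w i * cnj (w k) else 0) + a * a * w i * cnj (w j) * (w k * cnj (w k)))"
        by (intro sum.cong) (auto simp: algebra_simps)
      also have "\<dots> = (if i = j then 1 else 0) - 2 * a * w i * cnj (w j)
          + a * a * w i * cnj (w j) * complex_of_real M"
        using ij by (simp add: sum.distrib sum_subtractf Mc flip: sum_distrib_left)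
      also have "\<dots> = (if i = j then 1 else 0)"
        using \<open>M > 0\<close> by (simp add: a_def)
      finally show "(H * H) $$ (i, j) = 1\<^sub>m n $$ (i, j)" using ij by simp
    qed (use H in auto)
    moreover have "H *\<^sub>v unit_vec n 0 = c \<cdot>\<^sub>v v"
    proof (rule eq_vecI)
      fix i assume "i < dim_vec (c \<cdot>\<^sub>v v)"
      then have i: "i < n" using v by simp
      \<comment> \<open>The real first entry matters here: \<open>w 0 = u 0 - 1 = - M / 2\<close>,
        so the reflection sends \<open>e_0\<close> to \<open>e_0 + w = u\<close>.\<close>
      have w0: "cnj (w 0) = - complex_of_real (M / 2)"
        using u0 M by (simp add: w_def complex_eq_iff field_simps)
      have "(H *\<^sub>v unit_vec n 0) $ i = H $$ (i, 0)"
        using i n H by simp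
      also have "\<dots> = (if i = 0 then 1 else 0) + w i"
        using i n \<open>M > 0\<close> by (simp add: H_def w0)
      also have "\<dots> = (c \<cdot>\<^sub>v v) $ i" using i v by (simp add: w_def u_def)
      finally show "(H *\<^sub>v unit_vec n 0) $ i = (c \<cdot>\<^sub>v v) $ i" .
    qed (use v H in auto)
    ultimately show ?thesis using H adj c by blast
  qed
qed

lemma mat_adjoint_four_block:
  fixes A B C D :: "complex mat"
  assumes "A \<in> carrier_mat n1 m1" "B \<in> carrier_mat n1 m2" "C \<in> carrier_mat n2 m1" "D \<in> carrier_mat n2 m2"
  shows "mat_adjoint (four_block_mat A B C D)
    = four_block_mat (mat_adjoint A) (mat_adjoint C) (mat_adjoint B) (mat_adjoint D)"
  by (rule eq_matI) (use assms in auto)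

text \<open>Deflation: a reflection moves an eigenvector to the first basis vector. The first column
  is then a multiple of \<open>e_0\<close>, by hermiticity so is the first row, and the induction
  applies to the remaining block.\<close>

theorem psd_spectral:
  assumes "psd n A"
  shows "\<exists>U l. U \<in> carrier_mat n n \<and> mat_adjoint U * U = 1\<^sub>m n \<and> U * mat_adjoint U = 1\<^sub>m n
    \<and> (\<forall>i. 0 \<le> l i) \<and> A = U * mat_diag n (\<lambda>i. complex_of_real (l i)) * mat_adjoint U"
  using assms
proof (induction n arbitrary: A)
  case 0
  then have "A = 1\<^sub>m 0" by (intro eq_matI) (auto dest: psd_carrier)
  then show ?case
    by (intro exI[of _ "1\<^sub>m 0"] exI[of _ "\<lambda>_. 0"]) (auto intro!: eq_matI)
next
  case (Suc n)
  let ?N = "Suc n"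
  have A: "A \<in> carrier_mat ?N ?N" using Suc.prems psd_carrier by auto
  obtain e where "e \<in> spectrum A" using spectrum_non_empty[OF A] by auto
  then obtain v where v: "v \<in> carrier_vec ?N" "v \<noteq> 0\<^sub>v ?N" "A *\<^sub>v v = e \<cdot>\<^sub>v v"
    using A by (auto simp: spectrum_def eigenvalue_def eigenvector_def)
  obtain H c where H: "H \<in> carrier_mat ?N ?N" "mat_adjoint H = H" "H * H = 1\<^sub>m ?N"
    and c: "c \<noteq> 0" "H *\<^sub>v unit_vec ?N 0 = c \<cdot>\<^sub>v v"
    using unitary_first_column[OF v(1,2)] by blast
  define A' where "A' = H * A * H"
  have A': "A' \<in> carrier_mat ?N ?N" using A H by (simp add: A'_def)
  have psd': "psd ?N A'" using psd_congruence[OF Suc.prems H(1)] H by (simp add: A'_def)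
  have HA: "A = H * A' * H"
  proof -
    have "H * A' * H = (H * H) * A * (H * H)"
      using A H(1) by (simp add: A'_def assoc_mult_mat[of _ ?N ?N _ ?N _ ?N])
    then show ?thesis using A H by simp
  qed
  have "A' *\<^sub>v unit_vec ?N 0 = H *\<^sub>v (A *\<^sub>v (c \<cdot>\<^sub>v v))"
    using A H(1) c(2) by (simp add: A'_def assoc_mult_mat_vec[of _ ?N ?N _ ?N])
  also have "\<dots> = e \<cdot>\<^sub>v (H *\<^sub>v (c \<cdot>\<^sub>v v))"
    using A H(1) v by (simp add: mult_mat_vec[of _ ?N ?N] smult_smult_assoc mult.commute)
  also have "H *\<^sub>v (c \<cdot>\<^sub>v v) = (H * H) *\<^sub>v unit_vec ?N 0"
    using H(1) by (simp add: c(2)[symmetric] assoc_mult_mat_vec[of _ ?N ?N _ ?N])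
  finally have "A' *\<^sub>v unit_vec ?N 0 = e \<cdot>\<^sub>v unit_vec ?N 0"
    using H by simp
  moreover have "(A' *\<^sub>v unit_vec ?N 0) $ i = A' $$ (i, 0)" if "i < ?N" for i
    using A' that by simp
  ultimately have col: "A' $$ (i, 0) = (if i = 0 then e else 0)" if "i < ?N" for i
    using that by (metis index_smult_vec(1) index_unit_vec(1,3) mult.right_neutral mult_zero_right zero_less_Suc)
  have row: "A' $$ (0, i) = (if i = 0 then e else 0)" if "i < ?N" for i
    using that col[of i] A' psd_hermitian[OF psd']
      index_mat_adjoint[of 0 A' i] col[of 0] by (cases "i = 0") auto
  define l0 where "l0 = Re e"
  have e: "e = complex_of_real l0" "l0 \<ge> 0"
    using psd_diag_nonneg[OF psd', of 0] col[of 0] by (auto simp: less_eq_complex_def complex_eq_iff l0_def)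
  \<comment> \<open>The isometry onto the last \<open>n\<close> coordinates. It exhibits the lower
    right block as a congruence of \<open>A'\<close>, hence as positive semidefinite.\<close>
  define J :: "complex mat" where "J = mat ?N n (\<lambda>(i, j). if i = Suc j then 1 else 0)"
  have J: "J \<in> carrier_mat ?N n" by (simp add: J_def)
  define A3 where "A3 = mat_adjoint J * A' * J"
  have psd3: "psd n A3" unfolding A3_def by (rule psd_congruence[OF psd' J])
  have A'J: "A' * J = mat ?N n (\<lambda>(i, j). A' $$ (i, Suc j))"
    by (rule eq_matI) (use A' J in \<open>auto simp: J_def scalar_prod_def atLeast0LessThan if_distrib[of "\<lambda>x. _ * x"]
        simp del: sum.lessThan_Suc cong: if_cong\<close>)
  have A3: "A3 = mat n n (\<lambda>(i, j). A' $$ (Suc i, Suc j))"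
  proof -
    have "A3 = mat_adjoint J * mat ?N n (\<lambda>(i, j). A' $$ (i, Suc j))"
      unfolding A3_def A'J[symmetric] using J A' by (simp add: assoc_mult_mat[of _ n ?N _ ?N])
    also have "\<dots> = mat n n (\<lambda>(i, j). A' $$ (Suc i, Suc j))"
      by (rule eq_matI) (auto simp: J_def scalar_prod_def atLeast0LessThan if_distrib[of cnj] if_distrib[of "\<lambda>x. x * _"]
          simp del: sum.lessThan_Suc cong: if_cong)
    finally show ?thesis .
  qed
  have A'_block: "A' = four_block_mat (mat 1 1 (\<lambda>_. e)) (0\<^sub>m 1 n) (0\<^sub>m n 1) A3"
    by (rule eq_matI) (use A' row col in \<open>auto simp: A3\<close>)
  obtain U3 l where U3: "U3 \<in> carrier_mat n n" "mat_adjoint U3 * U3 = 1\<^sub>m n" "U3 * mat_adjoint U3 = 1\<^sub>m n"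
    and l: "\<And>i. 0 \<le> (l i :: real)" and A3_eq: "A3 = U3 * mat_diag n (\<lambda>i. complex_of_real (l i)) * mat_adjoint U3"
    using Suc.IH[OF psd3] by blast
  define W where "W = four_block_mat (1\<^sub>m 1) (0\<^sub>m 1 n) (0\<^sub>m n 1) U3"
  define D where "D = mat_diag ?N (\<lambda>i. complex_of_real (case_nat l0 l i))"
  have W: "W \<in> carrier_mat ?N ?N" using U3 by (auto simp: W_def)
  have D: "D \<in> carrier_mat ?N ?N" by (simp add: D_def)
  have zero_adj: "mat_adjoint (0\<^sub>m a b :: complex mat) = 0\<^sub>m b a" for a b by (rule eq_matI) auto
  have Wa: "mat_adjoint W = four_block_mat (1\<^sub>m 1) (0\<^sub>m 1 n) (0\<^sub>m n 1) (mat_adjoint U3)"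
    unfolding W_def by (subst mat_adjoint_four_block[of _ 1 1 _ n _ n]) (use U3 in \<open>auto simp: zero_adj\<close>)
  have one: "four_block_mat (1\<^sub>m 1) (0\<^sub>m 1 n) (0\<^sub>m n 1) (1\<^sub>m n) = (1\<^sub>m ?N :: complex mat)"
    by (rule eq_matI) auto
  have W1: "mat_adjoint W * W = 1\<^sub>m ?N" unfolding Wa unfolding W_def
    by (subst mult_four_block_mat[of _ 1 1 _ n _ n]) (use U3 one in \<open>auto\<close>)
  have W2: "W * mat_adjoint W = 1\<^sub>m ?N" unfolding Wa unfolding W_def
    by (subst mult_four_block_mat[of _ 1 1 _ n _ n]) (use U3 one in \<open>auto\<close>)
  have D_block: "D = four_block_mat (mat 1 1 (\<lambda>_. e)) (0\<^sub>m 1 n) (0\<^sub>m n 1) (mat_diag n (\<lambda>i. complex_of_real (l i)))"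
    unfolding D_def by (rule eq_matI) (auto simp: mat_diag_def e split: nat.split)
  have WD: "W * D = four_block_mat (mat 1 1 (\<lambda>_. e)) (0\<^sub>m 1 n) (0\<^sub>m n 1) (U3 * mat_diag n (\<lambda>i. complex_of_real (l i)))"
    unfolding W_def D_block
    by (subst mult_four_block_mat[of _ 1 1 _ n _ n _ _ 1 _ n])
      (use U3 left_mult_zero_mat[of "mat_diag n (\<lambda>i. complex_of_real (l i))" n n "Suc 0"] in \<open>auto\<close>)
  have A'_eq: "A' = W * D * mat_adjoint W"
    unfolding WD Wa A'_block A3_eq
    by (subst mult_four_block_mat[of _ 1 1 _ n _ n _ _ 1 _ n])
      (use U3 mult_carrier_mat[OF U3(1) mat_diag_dim[of n "\<lambda>i. complex_of_real (l i)"]]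
         right_mult_zero_mat[OF mult_carrier_mat[OF U3(1) mat_diag_dim[of n "\<lambda>i. complex_of_real (l i)"]]]
         mat_adjoint_carrier[OF U3(1)]
       in \<open>auto simp: left_add_zero_mat[of _ n n] mult_carrier_mat[of _ n n]\<close>)
  define U where "U = H * W"
  have Ua: "mat_adjoint U = mat_adjoint W * H"
    using H W by (simp add: U_def mat_adjoint_mult[of _ ?N ?N _ ?N])
  have "mat_adjoint U * U = mat_adjoint W * (H * H) * W"
    unfolding U_def using H(1) W mat_adjoint_carrier[OF W] by (simp add: mult_carrier_mat[of _ ?N ?N] Ua[unfolded U_def] assoc_mult_mat[of _ ?N ?N _ ?N _ ?N])
  then have U1: "mat_adjoint U * U = 1\<^sub>m ?N"
    using H W1 W mat_adjoint_carrier[OF W] by (simp add: right_mult_one_mat[of _ ?N ?N])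
  have "U * mat_adjoint U = H * (W * mat_adjoint W) * H"
    unfolding U_def using H(1) W mat_adjoint_carrier[OF W] by (simp add: mult_carrier_mat[of _ ?N ?N] Ua[unfolded U_def] assoc_mult_mat[of _ ?N ?N _ ?N _ ?N])
  then have U2: "U * mat_adjoint U = 1\<^sub>m ?N" using H W2 W by simp
  have "A = U * D * mat_adjoint U"
    unfolding HA A'_eq using H(1) W D mat_adjoint_carrier[OF W] by (simp add: mult_carrier_mat[of _ ?N ?N] Ua[unfolded U_def] U_def assoc_mult_mat[of _ ?N ?N _ ?N _ ?N])
  moreover have "\<forall>i. 0 \<le> case_nat l0 l i" using e l by (auto split: nat.split)
  ultimately show ?case using U1 U2 H(1) W unfolding D_def
    by (intro exI[of _ U] exI[of _ "case_nat l0 l"]) (auto simp: U_def)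
qed

lemma psd_diag_congruence:
  assumes "U \<in> carrier_mat n n" "\<And>i. 0 \<le> l i"
  shows "psd n (U * mat_diag n (\<lambda>i. complex_of_real (l i)) * mat_adjoint U)"
proof -
  define B where "B = mat_diag n (\<lambda>i. complex_of_real (sqrt (l i))) * mat_adjoint U"
  have B: "B \<in> carrier_mat n n" unfolding B_def by (rule mult_carrier_mat[of _ n n]) (use assms in auto)
  have D: "mat_diag n (\<lambda>i. complex_of_real (l i))
      = mat_diag n (\<lambda>i. complex_of_real (sqrt (l i))) * mat_diag n (\<lambda>i. complex_of_real (sqrt (l i)))"
    using assms by (simp flip: of_real_mult)
  have "mat_adjoint B = U * mat_diag n (\<lambda>i. complex_of_real (sqrt (l i)))"
    using assms unfolding B_def by (subst mat_adjoint_mult[of _ n n _ n]) (auto simp: mat_adjoint_diag)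
  then have "mat_adjoint B * B = U * mat_diag n (\<lambda>i. complex_of_real (l i)) * mat_adjoint U"
    using assms(1) mat_adjoint_carrier[OF assms(1)] mat_diag_dim[of n "\<lambda>i. complex_of_real (sqrt (l i))"]
    unfolding B_def D
    by (simp add: assoc_mult_mat[of _ n n _ n _ n] mult_carrier_mat[of _ n n] del: mat_diag_diag)
  then show ?thesis using psd_gram[OF B] by simp
qed

lemma unitary_diag_mult:
  assumes "U \<in> carrier_mat n n" "mat_adjoint U * U = 1\<^sub>m n"
  shows "(U * mat_diag n f * mat_adjoint U) * (U * mat_diag n g * mat_adjoint U)
    = U * mat_diag n (\<lambda>i. f i * g i) * (mat_adjoint U :: complex mat)"
proof -
  note c = assms(1) mat_adjoint_carrier[OF assms(1)] mat_diag_dim[of n f] mat_diag_dim[of n g]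
  have "(U * mat_diag n f * mat_adjoint U) * (U * mat_diag n g * mat_adjoint U)
    = U * mat_diag n f * (mat_adjoint U * U) * mat_diag n g * mat_adjoint U"
    using c by (simp add: assoc_mult_mat[of _ n n _ n _ n] mult_carrier_mat[of _ n n] del: mat_diag_diag)
  also have "\<dots> = U * (mat_diag n f * mat_diag n g) * mat_adjoint U"
    using c assms(2)
    by (simp add: assoc_mult_mat[of _ n n _ n _ n] left_mult_one_mat[of _ n n] mult_carrier_mat[of _ n n] del: mat_diag_diag)
  finally show ?thesis by simp
qed

section \<open>Square roots, and traces of products of positive semidefinite matrices\<close>

lemma psd_sqrt_exists:
  assumes "psd n A" shows "\<exists>B. psd n B \<and> B * B = A"
proof -
  obtain U l where U: "U \<in> carrier_mat n n" "mat_adjoint U * U = 1\<^sub>m n" "\<And>i. 0 \<le> (l i :: real)"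
    "A = U * mat_diag n (\<lambda>i. complex_of_real (l i)) * mat_adjoint U"
    using psd_spectral[OF assms] by blast
  define B where "B = U * mat_diag n (\<lambda>i. complex_of_real (sqrt (l i))) * mat_adjoint U"
  have "psd n B" unfolding B_def by (rule psd_diag_congruence) (use U in auto)
  moreover have "B * B = A" unfolding B_def U(4)
    by (subst unitary_diag_mult) (use U in \<open>auto simp flip: of_real_mult\<close>)
  ultimately show ?thesis by blast
qed

text \<open>The shift moves the spectrum away from 0, so that the root gets an inverse even if
  \<open>A\<close> is singular. Both are built in the eigenbasis of \<open>A\<close>.\<close>

lemma psd_shifted_sqrt:
  assumes "psd n A" "0 < \<epsilon>"
  shows "\<exists>S V. psd n S \<and> psd n V \<and> S * S = A + complex_of_real \<epsilon> \<cdot>\<^sub>m 1\<^sub>m n \<and> S * V = 1\<^sub>m n \<and> V * S = 1\<^sub>m n"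
proof -
  obtain U l where U: "U \<in> carrier_mat n n" "mat_adjoint U * U = 1\<^sub>m n" "U * mat_adjoint U = 1\<^sub>m n" "\<And>i. 0 \<le> (l i :: real)"
    "A = U * mat_diag n (\<lambda>i. complex_of_real (l i)) * mat_adjoint U"
    using psd_spectral[OF assms(1)] by blast
  have pos: "l i + \<epsilon> > 0" for i using U(4)[of i] assms by simp
  define S where "S = U * mat_diag n (\<lambda>i. complex_of_real (sqrt (l i + \<epsilon>))) * mat_adjoint U"
  define V where "V = U * mat_diag n (\<lambda>i. complex_of_real (1 / sqrt (l i + \<epsilon>))) * mat_adjoint U"
  have "mat_diag n (\<lambda>i. complex_of_real (l i + \<epsilon>))
      = mat_diag n (\<lambda>i. complex_of_real (l i)) + complex_of_real \<epsilon> \<cdot>\<^sub>m 1\<^sub>m n"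
    by (rule eq_matI) (auto simp: mat_diag_def)
  moreover have "U * (complex_of_real \<epsilon> \<cdot>\<^sub>m 1\<^sub>m n) * mat_adjoint U = complex_of_real \<epsilon> \<cdot>\<^sub>m 1\<^sub>m n"
    using U(1,3) mat_adjoint_carrier[OF U(1)]
    by (simp add: mult_smult_distrib[of _ n n _ n] mult_smult_assoc_mat[of _ n n _ n] right_mult_one_mat[of _ n n])
  ultimately have "U * mat_diag n (\<lambda>i. complex_of_real (l i + \<epsilon>)) * mat_adjoint U = A + complex_of_real \<epsilon> \<cdot>\<^sub>m 1\<^sub>m n"
    unfolding U(5) using U(1) mat_adjoint_carrier[OF U(1)]
    by (simp add: mult_add_distrib_mat[of _ n n _ n] add_mult_distrib_mat[of _ n n _ _ n])
  then have "S * S = A + complex_of_real \<epsilon> \<cdot>\<^sub>m 1\<^sub>m n"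
    unfolding S_def using U(1,2) pos by (subst unitary_diag_mult) (auto simp: less_imp_le simp flip: of_real_mult)
  moreover have "S * V = 1\<^sub>m n" "V * S = 1\<^sub>m n"
    unfolding S_def V_def using U(1,2,3) pos
    by (subst unitary_diag_mult, auto simp: less_imp_neq[symmetric] right_mult_one_mat[of _ n n] simp flip: of_real_mult)+
  moreover have "psd n S" "psd n V" unfolding S_def V_def
    by (rule psd_diag_congruence; use U(1) pos in \<open>simp add: less_imp_le\<close>)+
  ultimately show ?thesis by blast
qed

text \<open>\<open>A * B\<close> need not be Hermitian, but for a root \<open>C\<close> of
  \<open>A\<close> its trace is that of \<open>C * B * C\<close>.\<close>

lemma tr_psd_mult_nonneg:
  assumes "psd n A" "psd n B" shows "0 \<le> tr (A * B)"
proof -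
  obtain C where C: "psd n C" "C * C = A" using psd_sqrt_exists assms by blast
  have c: "C \<in> carrier_mat n n" "B \<in> carrier_mat n n" using C assms psd_carrier by auto
  have "tr (A * B) = tr (C * (C * B))" unfolding C(2)[symmetric] using c by simp
  also have "\<dots> = tr (C * B * C)" using c by (subst tr_mult_comm[of _ n n]) auto
  also have "\<dots> \<ge> 0" using psd_congruence[OF assms(2) c(1)] psd_hermitian[OF C(1)] tr_psd_nonneg by auto
  finally show ?thesis .
qed

text \<open>For a root \<open>C\<close> of \<open>B\<close> the trace is the squared Hilbert-Schmidt
  norm of \<open>C * D\<close>.\<close>

lemma psd_mult_eq_0:
  assumes "psd n B" "D \<in> carrier_mat n n" "tr (mat_adjoint D * B * D) = 0"
  shows "B * D = 0\<^sub>m n n"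
proof -
  obtain C where C: "psd n C" "C * C = B" using psd_sqrt_exists assms by blast
  have c: "C \<in> carrier_mat n n" using C psd_carrier by auto
  have "mat_adjoint (C * D) * (C * D) = mat_adjoint D * B * D"
    unfolding C(2)[symmetric] using c assms(2) psd_hermitian[OF C(1)]
    by (simp add: mat_adjoint_mult[of _ n n _ n] assoc_mult_mat[of _ n n _ n _ n])
  then have "C * D = 0\<^sub>m n n" using adjoint_mult_eq_0[of "C * D" n n] c assms by auto
  then show ?thesis unfolding C(2)[symmetric] using c assms(2) by simp
qed

text \<open>For \<open>D = B - C\<close> one has \<open>B * D + D * C = B * B - C * C = 0\<close>.
  Multiplying by \<open>D\<close> and taking traces gives two nonnegative numbers
  \<open>tr (D * B * D)\<close> and \<open>tr (D * C * D)\<close> with sum 0. Hence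
  \<open>B * D = C * D = 0\<close>, and \<open>D * D\<close>, their difference, vanishes.\<close>

lemma psd_sqrt_unique:
  assumes "psd n B" "psd n C" "B * B = C * C" shows "B = C"
proof -
  have c: "B \<in> carrier_mat n n" "C \<in> carrier_mat n n" using assms psd_carrier by auto
  define D where "D = B - C"
  have D: "D \<in> carrier_mat n n" "mat_adjoint D = D"
    using c psd_hermitian[OF assms(1)] psd_hermitian[OF assms(2)]
    by (auto simp: D_def mat_adjoint_minus[of _ n n])
  have "B * D + D * C = 0\<^sub>m n n"
  proof -
    have "B * D + D * C = (B * B - B * C) + (B * C - C * C)"
      using c by (simp add: D_def minus_mult_distrib_mat[of _ n n _ _ n] mult_minus_distrib_mat[of _ n n _ n])
    also have "\<dots> = 0\<^sub>m n n" by (rule eq_matI) (use c assms(3) in auto)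
    finally show ?thesis .
  qed
  then have "D * (B * D + D * C) = 0\<^sub>m n n" using D(1) by simp
  then have "D * B * D + D * (D * C) = 0\<^sub>m n n"
    using c D(1) by (simp add: mult_add_distrib_mat[of _ n n _ n])
  then have "tr (D * B * D) + tr (D * (D * C)) = tr (0\<^sub>m n n)"
    using c D(1) by (subst tr_add[symmetric, of _ n]) auto
  moreover have "tr (D * (D * C)) = tr (D * C * D)"
    using c D(1) by (subst tr_mult_comm[of _ n n]) auto
  moreover have "tr (0\<^sub>m n n) = 0" by (simp add: tr_def)
  moreover have "tr (D * B * D) \<ge> 0" "tr (D * C * D) \<ge> 0"
    using psd_congruence[OF assms(1) D(1)] psd_congruence[OF assms(2) D(1)] D(2) tr_psd_nonneg by auto
  ultimately have "tr (D * B * D) = 0" "tr (D * C * D) = 0" by auto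
  then have "B * D = 0\<^sub>m n n" "C * D = 0\<^sub>m n n"
    using psd_mult_eq_0 assms D by auto
  moreover have "D * D = B * D - C * D"
    using minus_mult_distrib_mat[OF c D(1)] by (simp flip: D_def)
  ultimately have "D * D = 0\<^sub>m n n" by simp
  then have "tr (mat_adjoint D * D) = 0" using D(2) by (simp add: tr_def)
  then have "D = 0\<^sub>m n n" using adjoint_mult_eq_0 D by blast
  show ?thesis
  proof (rule eq_matI)
    fix i j assume "i < dim_row C" "j < dim_col C"
    then have "B $$ (i, j) - C $$ (i, j) = D $$ (i, j)"
      using c by (simp add: D_def)
    also have "\<dots> = 0" unfolding \<open>D = 0\<^sub>m n n\<close> using \<open>i < dim_row C\<close> \<open>j < dim_col C\<close> c by simp
    finally have "B $$ (i, j) - C $$ (i, j) = 0" .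
    then show "B $$ (i, j) = C $$ (i, j)" by simp
  qed (use c in auto)
qed

lemma op_sqrt_eqI:
  assumes "psd n B" "B * B = A" shows "op_sqrt A = B"
proof -
  have "dim_row A = n" using psd_carrier[OF assms(1)] assms(2) by auto
  then show ?thesis unfolding op_sqrt_def
    using assms psd_sqrt_unique by (intro the_equality) auto
qed

lemma op_sqrt_psd:
  assumes "psd n A" shows "psd n (op_sqrt A)" "op_sqrt A * op_sqrt A = A"
proof -
  obtain B where "psd n B" "B * B = A" using psd_sqrt_exists assms by blast
  then show "psd n (op_sqrt A)" "op_sqrt A * op_sqrt A = A" using op_sqrt_eqI by auto
qed

section \<open>Bounds on the fidelity\<close>

text \<open>With \<open>K = V P V\<close> one has \<open>R = K S\<^sup>2 K\<close>, so that \<open>tr P\<close> and \<open>tr R\<close> are the first and second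
  moments of \<open>K\<close> with respect to the weight \<open>S\<^sup>2\<close>, while \<open>tr (V R V R)\<close> dominates the fourth
  moment. The inequality is \<open>K (K - 1)\<^sup>2 (K + 2) \<ge> 0\<close>.\<close>

lemma trace_moment_inequality:
  assumes R: "psd N R" and P: "psd N P" and S: "psd N S" and V: "psd N V"
    and SV: "S * V = 1\<^sub>m N" and VS: "V * S = 1\<^sub>m N" and PP: "P * P = S * R * S"
  shows "3 * tr R \<le> 2 * tr P + tr (V * R * V * R)"
proof -
  note c = psd_carrier[OF R] psd_carrier[OF P] psd_carrier[OF S] psd_carrier[OF V]
  note a = assoc_mult_mat[of _ N N _ N _ N]
  have cyc: "tr (A * B) = tr (B * A)" if "A \<in> carrier_mat N N" "B \<in> carrier_mat N N" for A B
    using that by (rule tr_mult_comm)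
  have SVX: "S * (V * X) = X" if "X \<in> carrier_mat N N" for X
    using c that SV by (simp flip: a)
  have VSX: "V * (S * X) = X" if "X \<in> carrier_mat N N" for X
    using c that VS by (simp flip: a)
  define K where "K = V * P * V"
  have K: "psd N K" using psd_congruence[OF P c(4)] psd_hermitian[OF V] by (simp add: K_def)
  note k = psd_carrier[OF K]
  have hK: "mat_adjoint K = K" and hS: "mat_adjoint S = S" and hR: "mat_adjoint R = R"
    using K S R psd_hermitian by auto
  have PPX: "P * (P * X) = S * (R * (S * X))" if "X \<in> carrier_mat N N" for X
  proof -
    have "P * (P * X) = (P * P) * X" using c that by (simp add: a)
    also have "\<dots> = S * (R * (S * X))" unfolding PP using c that by (simp add: a)
    finally show ?thesis .
  qed
  have R_eq: "K * (S * (S * K)) = R"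
    using c by (simp add: K_def a SVX VSX PPX SV VS)
  have trP: "tr (S * (S * K)) = tr P"
  proof -
    have "tr (S * (S * K)) = tr (S * K * S)" using c k by (subst cyc) (auto simp: a)
    also have "S * K * S = P" using c by (simp add: K_def a SVX VSX VS)
    finally show ?thesis .
  qed
  have trR: "tr (S * (S * (K * K))) = tr R"
  proof -
    have "tr (S * (S * (K * K))) = tr ((S * (S * K)) * K)" using c k by (simp add: a)
    also have "\<dots> = tr (K * (S * (S * K)))" using c k by (subst cyc) auto
    finally show ?thesis using R_eq by simp
  qed
  define m3 where "m3 = tr (S * (S * (K * (K * K))))"
  define m4 where "m4 = tr (S * (S * (K * (K * (K * K)))))"
  define Q where "Q = tr (V * (R * (V * R)))"
  have m4_le: "m4 \<le> Q"
  proof -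
    \<comment> \<open>\<open>R = K S S K\<close> with the factors in the other order, equal to
      \<open>R\<close> if \<open>K\<close> and \<open>S\<close> commute. Both cross terms of
      \<open>tr (V H V H) \<ge> 0\<close> are \<open>m4\<close>, and the term quadratic in
      \<open>L\<close> is at most \<open>m4\<close>, which leaves \<open>m4 \<le> Q\<close>.\<close>
    define L where "L = S * (K * (K * S))"
    have L: "L \<in> carrier_mat N N" "mat_adjoint L = L"
      using c k hK hS by (auto simp: L_def mat_adjoint_mult[of _ N N _ N] a)
    define H where "H = R - L"
    have H: "H \<in> carrier_mat N N" "mat_adjoint H = H"
      using c L hR by (auto simp: H_def mat_adjoint_minus[of _ N N])
    have "0 \<le> tr (V * (H * (V * H)))"
      using tr_psd_mult_nonneg[OF V psd_congruence[OF V H(1)]] H c by (simp add: a)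
    also have "V * (H * (V * H)) = (V * (R * (V * R)) - V * (L * (V * R))) - (V * (R * (V * L)) - V * (L * (V * L)))"
      using c L(1) by (simp add: H_def minus_mult_distrib_mat[of _ N N _ _ N] mult_minus_distrib_mat[of _ N N _ N] minus_carrier_mat[of _ N N])
    also have "tr \<dots> = Q - tr (V * (L * (V * R))) - (tr (V * (R * (V * L))) - tr (V * (L * (V * L))))"
      using c L(1) by (simp add: tr_minus[of _ N] minus_carrier_mat[of _ N N] Q_def)
    finally have pos: "0 \<le> Q - tr (V * (L * (V * R))) - (tr (V * (R * (V * L))) - tr (V * (L * (V * L))))" .
    have cross: "tr (V * (R * (V * L))) = tr (V * (L * (V * R)))"
      using c L(1) cyc[of "V * R" "V * L"] by (simp add: a)
    have cross_m4: "tr (V * (L * (V * R))) = m4"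
    proof -
      have "tr (V * (L * (V * R))) = tr (K * (K * R))" using c k by (simp add: L_def a VSX SVX)
      also have "K * (K * R) = K * (K * (K * (S * (S * K))))" by (simp only: R_eq)
      also have "\<dots> = (K * (K * K)) * (S * (S * K))" using c k by (simp add: a)
      also have "tr \<dots> = tr ((S * (S * K)) * (K * (K * K)))" using c k by (subst cyc) auto
      also have "\<dots> = m4" using c k by (simp add: a m4_def)
      finally show ?thesis .
    qed
    have "tr (V * (L * (V * L))) = tr (K * (K * (S * (K * (K * S)))))"
      using c k by (simp add: L_def a VSX SVX)
    also have "tr (K * (K * (S * (K * (K * S))))) \<le> m4"
    proof -
      \<comment> \<open>\<open>A - B\<close> is the commutator of \<open>K * K\<close> and
        \<open>S\<close>; its squared Hilbert-Schmidt norm is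
        \<open>2 * (m4 - tr (A * A))\<close>.\<close>
      define A where "A = K * (K * S)"
      define B where "B = S * (K * K)"
      have AB: "A \<in> carrier_mat N N" "B \<in> carrier_mat N N" "mat_adjoint A = B" "mat_adjoint B = A"
        using c k hK hS by (auto simp: A_def B_def mat_adjoint_mult[of _ N N _ N] a)
      have "0 \<le> tr (mat_adjoint (A - B) * (A - B))"
        using psd_gram[of "A - B" N N] AB tr_psd_nonneg by (auto simp: minus_carrier_mat)
      also have "mat_adjoint (A - B) * (A - B) = (B * A - A * A) - (B * B - A * B)"
        using AB by (simp add: mat_adjoint_minus[of _ N N] minus_mult_distrib_mat[of _ N N _ _ N]
            mult_minus_distrib_mat[of _ N N _ N] minus_carrier_mat[of _ N N])
      also have "tr \<dots> = tr (B * A) - tr (A * A) - (tr (B * B) - tr (A * B))"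
        using AB by (simp add: tr_minus[of _ N] minus_carrier_mat[of _ N N])
      finally have pos: "0 \<le> tr (B * A) - tr (A * A) - (tr (B * B) - tr (A * B))" .
      have "tr (B * A) = m4"
      proof -
        have "tr (B * A) = tr ((S * (K * (K * (K * K)))) * S)" using c k by (simp add: A_def B_def a)
        also have "\<dots> = m4" using c k by (subst cyc) (auto simp: m4_def)
        finally show ?thesis .
      qed
      moreover have "tr (A * B) = tr (B * A)"
        by (rule cyc[OF AB(1,2)])
      moreover have "tr (B * B) = tr (A * A)"
      proof -
        have "tr (B * B) = tr ((S * (K * (K * S))) * (K * K))" using c k by (simp add: B_def a)
        also have "\<dots> = tr ((K * K) * (S * (K * (K * S))))" using c k by (subst cyc) auto
        also have "\<dots> = tr (A * A)" using c k by (simp add: A_def a)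
        finally show ?thesis .
      qed
      ultimately have "tr (A * A) \<le> m4" using pos by linarith
      then show ?thesis using c k by (simp add: A_def a)
    qed
    finally show ?thesis using pos cross cross_m4 by linarith
  qed
  have T: "psd N (S * S)" using psd_gram[OF c(3)] hS by simp
  \<comment> \<open>K (K - 1)^2 (K + 2) is split as 2 K (K - 1)^2 + K^2 (K - 1)^2. The summands are
    handled as \<open>D * K * D\<close> and \<open>E * E\<close>, which are positive semidefinite on
    sight; fact \<open>1\<close> enters twice, fact \<open>2\<close> once.\<close>
  define D where "D = K - 1\<^sub>m N"
  have D: "D \<in> carrier_mat N N" "mat_adjoint D = D"
    using k hK by (auto simp: D_def mat_adjoint_minus[of _ N N])
  have "0 \<le> tr ((S * S) * (D * (K * D)))"
    using tr_psd_mult_nonneg[OF T psd_congruence[OF K D(1)]] D k by (simp add: a)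
  also have "D * (K * D) = (K * (K * K) - K * K) - (K * K - K)"
    using k by (simp add: D_def minus_mult_distrib_mat[of _ N N _ _ N] mult_minus_distrib_mat[of _ N N _ N] minus_carrier_mat[of _ N N])
  also have "tr ((S * S) * \<dots>) = m3 - tr R - (tr R - tr P)"
    using c k by (simp add: mult_minus_distrib_mat[of _ N N _ N] minus_carrier_mat[of _ N N] tr_minus[of _ N] minus_carrier_mat[of _ N N] m3_def a flip: trR trP)
  finally have 1: "0 \<le> m3 - 2 * tr R + tr P" by simp
  define E where "E = K * K - K"
  have E: "E \<in> carrier_mat N N" "mat_adjoint E = E"
    using k hK by (auto simp: E_def mat_adjoint_minus[of _ N N] mat_adjoint_mult[of _ N N _ N])
  have "0 \<le> tr ((S * S) * (E * E))"
    using tr_psd_mult_nonneg[OF T psd_gram[OF E(1)]] E by simp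
  also have "E * E = (K * (K * (K * K)) - K * (K * K)) - (K * (K * K) - K * K)"
    using k by (simp add: E_def minus_mult_distrib_mat[of _ N N _ _ N] mult_minus_distrib_mat[of _ N N _ N] minus_carrier_mat[of _ N N] a)
  also have "tr ((S * S) * \<dots>) = m4 - m3 - (m3 - tr R)"
    using c k by (simp add: mult_minus_distrib_mat[of _ N N _ N] minus_carrier_mat[of _ N N] tr_minus[of _ N] minus_carrier_mat[of _ N N] m3_def m4_def a flip: trR)
  finally have 2: "0 \<le> m4 - 2 * m3 + tr R" by simp
  have "tr (V * R * V * R) = Q" using c by (simp add: Q_def a)
  then show ?thesis using 1 2 m4_le by simp
qed

text \<open>The Gram matrix of \<open>op_sqrt R * S\<close> is \<open>S * R * S\<close>, whose root
  is the \<open>P\<close> of the moment inequality.\<close>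

lemma trace_norm_sqrt_mult:
  assumes "psd N R" "psd N S"
  shows "trace_norm (op_sqrt R * S) = tr (op_sqrt (S * R * S))" "psd N (S * R * S)"
proof -
  let ?X = "op_sqrt R"
  have X: "psd N ?X" "?X * ?X = R" using op_sqrt_psd[OF assms(1)] by auto
  note c = psd_carrier[OF X(1)] psd_carrier[OF assms(2)]
  have "mat_adjoint (?X * S) * (?X * S) = S * (?X * ?X) * S"
    using c psd_hermitian[OF X(1)] psd_hermitian[OF assms(2)]
    by (simp add: mat_adjoint_mult[of _ N N _ N] assoc_mult_mat[of _ N N _ N _ N])
  then show "trace_norm (op_sqrt R * S) = tr (op_sqrt (S * R * S))"
    unfolding trace_norm_def X(2) by simp
  show "psd N (S * R * S)"
    using psd_congruence[OF assms(1) c(2)] psd_hermitian[OF assms(2)] by simp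
qed

lemma smult_smult_mat: "a \<cdot>\<^sub>m (b \<cdot>\<^sub>m A) = (a * b) \<cdot>\<^sub>m (A :: 'a :: semigroup_mult mat)"
  by (rule eq_matI) (auto simp: mult.assoc)

text \<open>The moment inequality is not homogeneous in \<open>R\<close>. Applied to
  \<open>c\<^sup>2 R\<close> and \<open>c P\<close> it leaves a scale that can be tuned so that
  \<open>K\<close> is close to 1, where it is tight.\<close>

lemma trace_norm_lower_bound:
  assumes R: "psd N R" and S: "psd N S" and V: "psd N V"
    and SV: "S * V = 1\<^sub>m N" and VS: "V * S = 1\<^sub>m N" and "0 \<le> c"
  shows "3 * c\<^sup>2 * tr R \<le> 2 * c * trace_norm (op_sqrt R * S) + c ^ 4 * tr (V * R * V * R)"
proof -
  let ?P = "op_sqrt (S * R * S)"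
  have P: "psd N ?P" "?P * ?P = S * R * S"
    using op_sqrt_psd trace_norm_sqrt_mult[OF R S] by auto
  note k = psd_carrier[OF R] psd_carrier[OF S] psd_carrier[OF V] psd_carrier[OF P(1)]
  let ?c = "complex_of_real c" and ?c2 = "complex_of_real (c\<^sup>2)"
  have "(?c \<cdot>\<^sub>m ?P) * (?c \<cdot>\<^sub>m ?P) = ?c2 \<cdot>\<^sub>m (?P * ?P)"
    using k by (simp add: mult_smult_distrib[of _ N N _ N] mult_smult_assoc_mat[of _ N N _ N] power2_eq_square
        smult_smult_mat)
  then have "(?c \<cdot>\<^sub>m ?P) * (?c \<cdot>\<^sub>m ?P) = S * (?c2 \<cdot>\<^sub>m R) * S"
    using k unfolding P(2) by (simp add: mult_smult_distrib[of _ N N _ N] mult_smult_assoc_mat[of _ N N _ N])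
  then have "3 * tr (?c2 \<cdot>\<^sub>m R) \<le> 2 * tr (?c \<cdot>\<^sub>m ?P) + tr (V * (?c2 \<cdot>\<^sub>m R) * V * (?c2 \<cdot>\<^sub>m R))"
    using assms P psd_smult[OF R, of "c\<^sup>2"] psd_smult[OF P(1), of c]
    by (intro trace_moment_inequality[of N _ _ S]) auto
  moreover have "V * (?c2 \<cdot>\<^sub>m R) * V * (?c2 \<cdot>\<^sub>m R) = complex_of_real (c ^ 4) \<cdot>\<^sub>m (V * R * V * R)"
    using k by (simp add: mult_smult_distrib[of _ N N _ N] mult_smult_assoc_mat[of _ N N _ N]
        smult_smult_mat power_add[symmetric] flip: of_real_mult)
  moreover have "tr (?c2 \<cdot>\<^sub>m R) = c\<^sup>2 * tr R" "tr (?c \<cdot>\<^sub>m ?P) = c * tr ?P"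
    by (rule tr_smult, rule k)+
  moreover have "tr (complex_of_real (c ^ 4) \<cdot>\<^sub>m (V * R * V * R)) = c ^ 4 * tr (V * R * V * R)"
    using k by (intro tr_smult[of _ N]) auto
  ultimately show ?thesis using trace_norm_sqrt_mult[OF R S] by simp
qed

text \<open>For roots \<open>C\<close> and \<open>D\<close> of \<open>A\<close> and \<open>B\<close>
  this is submultiplicativity of the Hilbert-Schmidt norm, applied to \<open>C * D\<close>.\<close>

lemma tr_psd_mult_le:
  assumes "psd N A" "psd N B" shows "tr (A * B) \<le> tr A * tr B"
proof -
  obtain C D where C: "psd N C" "C * C = A" and D: "psd N D" "D * D = B"
    using psd_sqrt_exists assms by metis
  note c = psd_carrier[OF C(1)] psd_carrier[OF D(1)]
  note h = psd_hermitian[OF C(1)] psd_hermitian[OF D(1)]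
  have "tr (A * B) = tr ((C * (C * D)) * D)"
    using c by (simp flip: C(2) D(2) add: assoc_mult_mat[of _ N N _ N _ N])
  also have "\<dots> = tr (mat_adjoint (C * D) * (C * D))"
    using c h by (subst tr_mult_comm[of _ N N])
      (auto simp: mat_adjoint_mult[of _ N N _ N] assoc_mult_mat[of _ N N _ N _ N])
  also have "\<dots> = (\<Sum>i<N. \<Sum>j<N. (cmod ((C * D) $$ (j, i)))\<^sup>2)"
    using c by (intro tr_adjoint_mult) auto
  also have "\<dots> \<le> (\<Sum>i<N. \<Sum>j<N. (\<Sum>k<N. (cmod (C $$ (k, j)))\<^sup>2) * (\<Sum>k<N. (cmod (D $$ (k, i)))\<^sup>2))"
  proof (intro sum_mono)
    fix i j assume ij: "i \<in> {..<N}" "j \<in> {..<N}"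
    have "C $$ (j, k) = cnj (C $$ (k, j))" if "k < N" for k
      using c ij that h index_mat_adjoint[of j C k] by auto
    then have sym: "cmod (C $$ (j, k)) = cmod (C $$ (k, j))" if "k < N" for k
      using that by simp
    have "cmod ((C * D) $$ (j, i)) \<le> (\<Sum>k<N. cmod (C $$ (j, k) * D $$ (k, i)))"
      using c ij by (auto simp: scalar_prod_def atLeast0LessThan intro!: sum_norm_le)
    also have "\<dots> = (\<Sum>k<N. cmod (C $$ (k, j)) * cmod (D $$ (k, i)))"
      by (intro sum.cong) (auto simp: norm_mult sym)
    finally have "(cmod ((C * D) $$ (j, i)))\<^sup>2 \<le> (\<Sum>k<N. cmod (C $$ (k, j)) * cmod (D $$ (k, i)))\<^sup>2"
      by (intro power_mono) auto
    also have "\<dots> \<le> (\<Sum>k<N. (cmod (C $$ (k, j)))\<^sup>2) * (\<Sum>k<N. (cmod (D $$ (k, i)))\<^sup>2)"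
      by (rule Cauchy_Schwarz_ineq_sum)
    finally show "(cmod ((C * D) $$ (j, i)))\<^sup>2
      \<le> (\<Sum>k<N. (cmod (C $$ (k, j)))\<^sup>2) * (\<Sum>k<N. (cmod (D $$ (k, i)))\<^sup>2)" .
  qed
  also have "\<dots> = tr (mat_adjoint C * C) * tr (mat_adjoint D * D)"
    unfolding tr_adjoint_mult[OF c(1)] tr_adjoint_mult[OF c(2)]
    by (subst sum.swap) (simp add: sum_product)
  finally show ?thesis using h C D by simp
qed

text \<open>Cauchy-Schwarz on the diagonal of \<open>P\<close>. The factor \<open>N\<close> is
  crude, but the bound only serves to show that the supremum in \<open>H_max\<close> is
  finite.\<close>

lemma trace_norm_upper_bound:
  assumes R: "psd N R" and S: "psd N S"
  shows "(trace_norm (op_sqrt R * S))\<^sup>2 \<le> N * tr R * tr (S * S)"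
proof -
  let ?P = "op_sqrt (S * R * S)"
  have P: "psd N ?P" "?P * ?P = S * R * S"
    using op_sqrt_psd trace_norm_sqrt_mult[OF R S] by auto
  note k = psd_carrier[OF R] psd_carrier[OF S] psd_carrier[OF P(1)]
  have "(tr ?P)\<^sup>2 = (\<Sum>i<N. 1 * Re (?P $$ (i, i)))\<^sup>2"
    by (simp add: tr_carrier[OF k(3)])
  also have "\<dots> \<le> (\<Sum>i<N. 1\<^sup>2) * (\<Sum>i<N. (Re (?P $$ (i, i)))\<^sup>2)"
    by (rule Cauchy_Schwarz_ineq_sum)
  also have "\<dots> = N * (\<Sum>i<N. (Re (?P $$ (i, i)))\<^sup>2)" by simp
  also have "\<dots> \<le> N * (\<Sum>i<N. \<Sum>j<N. (cmod (?P $$ (j, i)))\<^sup>2)"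
  proof (intro mult_left_mono sum_mono)
    fix i assume i: "i \<in> {..<N}"
    have "(Re (?P $$ (i, i)))\<^sup>2 \<le> (cmod (?P $$ (i, i)))\<^sup>2"
      by (simp add: cmod_power2)
    also have "\<dots> \<le> (\<Sum>j<N. (cmod (?P $$ (j, i)))\<^sup>2)"
      using i by (intro member_le_sum) auto
    finally show "(Re (?P $$ (i, i)))\<^sup>2 \<le> (\<Sum>j<N. (cmod (?P $$ (j, i)))\<^sup>2)" .
  qed auto
  also have "(\<Sum>i<N. \<Sum>j<N. (cmod (?P $$ (j, i)))\<^sup>2) = tr (S * R * S)"
    using tr_adjoint_mult[OF k(3)] psd_hermitian[OF P(1)] P(2) by simp
  also have "tr (S * R * S) = tr (R * (S * S))"
    using k tr_mult_comm[of S N N "R * S"] by (simp add: assoc_mult_mat[of _ N N _ N _ N])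
  also have "N * \<dots> \<le> N * (tr R * tr (S * S))"
    using tr_psd_mult_le[OF R psd_gram[OF k(2)]] psd_hermitian[OF S] by (intro mult_left_mono) auto
  finally show ?thesis using trace_norm_sqrt_mult[OF R S] by (simp add: mult.assoc)
qed

section \<open>Block diagonal matrices\<close>

text \<open>Row \<open>i * d + a\<close> is entry \<open>a\<close> of block \<open>i\<close>, the
  ordering of \<open>tensor_op\<close> with the classical register first. Products, traces and
  positivity of classical-quantum states are all computed blockwise in this form.\<close>

definition bdiag :: "nat \<Rightarrow> nat \<Rightarrow> (nat \<Rightarrow> complex mat) \<Rightarrow> complex mat" where
  "bdiag N d X = mat (N * d) (N * d)
     (\<lambda>(i, j). if i div d = j div d then X (i div d) $$ (i mod d, j mod d) else 0)"

lemma bdiag_carrier [simp]: "bdiag N d X \<in> carrier_mat (N * d) (N * d)"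
  by (simp add: bdiag_def)

lemma bdiag_cong:
  assumes "\<And>i. i < N \<Longrightarrow> X i = Y i" shows "bdiag N d X = bdiag N d Y"
  by (rule eq_matI) (auto simp: bdiag_def assms less_mult_imp_div_less)

lemma sum_blocks:
  fixes f :: "nat \<Rightarrow> 'a :: comm_monoid_add"
  shows "(\<Sum>r<N * d. f r) = (\<Sum>i<N. \<Sum>a<d. f (i * d + a))"
proof -
  have "(\<Sum>r<N * d. f r) = (\<Sum>i<N. sum f {i * d..<i * d + d})"
    by (rule sum.nat_group[symmetric])
  also have "\<dots> = (\<Sum>i<N. \<Sum>a<d. f (i * d + a))"
  proof (rule sum.cong[OF refl])
    fix i
    show "sum f {i * d..<i * d + d} = (\<Sum>a<d. f (i * d + a))"
      using sum.shift_bounds_nat_ivl[of f 0 "i * d" d] by (simp add: atLeast0LessThan add.commute)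
  qed
  finally show ?thesis .
qed

lemma block_less: "i < N \<Longrightarrow> a < d \<Longrightarrow> i * d + a < N * (d :: nat)"
proof -
  assume "i < N" "a < d"
  then have "i * d + a < Suc i * d" by simp
  also have "\<dots> \<le> N * d" using \<open>i < N\<close> by (intro mult_le_mono1) simp
  finally show ?thesis .
qed

lemma bdiag_mult:
  assumes "\<And>i. i < N \<Longrightarrow> X i \<in> carrier_mat d d" "\<And>i. i < N \<Longrightarrow> Y i \<in> carrier_mat d d"
  shows "bdiag N d X * bdiag N d Y = bdiag N d (\<lambda>i. X i * Y i)"
proof (rule eq_matI)
  fix i j assume "i < dim_row (bdiag N d (\<lambda>i. X i * Y i))" "j < dim_col (bdiag N d (\<lambda>i. X i * Y i))"
  then have ij: "i < N * d" "j < N * d" by (auto simp: bdiag_def)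
  then have d: "0 < d" by (cases d) auto
  have b: "i div d < N" "j div d < N" "i mod d < d" "j mod d < d"
    using ij d by (auto simp: less_mult_imp_div_less)
  have "(bdiag N d X * bdiag N d Y) $$ (i, j) = (\<Sum>r<N * d. bdiag N d X $$ (i, r) * bdiag N d Y $$ (r, j))"
    using ij by (simp add: bdiag_def scalar_prod_def atLeast0LessThan)
  also have "\<dots> = (\<Sum>k<N. \<Sum>a<d. bdiag N d X $$ (i, k * d + a) * bdiag N d Y $$ (k * d + a, j))"
    by (rule sum_blocks)
  also have "\<dots> = (\<Sum>k<N. if k = i div d then
      if i div d = j div d then \<Sum>a<d. X k $$ (i mod d, a) * Y k $$ (a, j mod d) else 0 else 0)"
    using ij d by (intro sum.cong) (auto simp: bdiag_def block_less intro!: sum.neutral sum.cong)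
  also have "\<dots> = (if i div d = j div d then \<Sum>a<d. X (i div d) $$ (i mod d, a) * Y (i div d) $$ (a, j mod d) else 0)"
    using b by simp
  also have "\<dots> = bdiag N d (\<lambda>i. X i * Y i) $$ (i, j)"
    using ij b assms(1,2)[OF b(1)] by (auto simp: bdiag_def scalar_prod_def atLeast0LessThan)
  finally show "(bdiag N d X * bdiag N d Y) $$ (i, j) = bdiag N d (\<lambda>i. X i * Y i) $$ (i, j)" .
qed (auto simp: bdiag_def)

lemma tr_bdiag:
  assumes "\<And>i. i < N \<Longrightarrow> X i \<in> carrier_mat d d"
  shows "tr (bdiag N d X) = (\<Sum>i<N. tr (X i))"
proof -
  have "tr (bdiag N d X) = (\<Sum>i<N. \<Sum>a<d. Re (bdiag N d X $$ (i * d + a, i * d + a)))"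
    by (simp add: tr_carrier[OF bdiag_carrier] sum_blocks)
  also have "\<dots> = (\<Sum>i<N. tr (X i))"
    using assms by (intro sum.cong) (auto simp: bdiag_def block_less tr_carrier[of _ d])
  finally show ?thesis .
qed

lemma bdiag_one: "bdiag N d (\<lambda>_. 1\<^sub>m d) = 1\<^sub>m (N * d)"
proof (rule eq_matI)
  fix i j assume "i < dim_row (1\<^sub>m (N * d) :: complex mat)" "j < dim_col (1\<^sub>m (N * d) :: complex mat)"
  then have ij: "i < N * d" "j < N * d" by auto
  then have d: "0 < d" by (cases d) auto
  then show "bdiag N d (\<lambda>_. 1\<^sub>m d) $$ (i, j) = 1\<^sub>m (N * d) $$ (i, j)"
    using ij by (auto simp: bdiag_def) (metis div_mod_decomp)+
qed (auto simp: bdiag_def)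

lemma bdiag_minus:
  assumes "\<And>i. i < N \<Longrightarrow> X i \<in> carrier_mat d d" "\<And>i. i < N \<Longrightarrow> Y i \<in> carrier_mat d d"
  shows "bdiag N d X - bdiag N d Y = bdiag N d (\<lambda>i. X i - Y i)"
proof (rule eq_matI)
  fix i j assume "i < dim_row (bdiag N d (\<lambda>i. X i - Y i))" "j < dim_col (bdiag N d (\<lambda>i. X i - Y i))"
  then have ij: "i < N * d" "j < N * d" by (auto simp: bdiag_def)
  then have d: "0 < d" by (cases d) auto
  have b: "i div d < N" "i mod d < d" "j mod d < d"
    using ij d by (auto simp: less_mult_imp_div_less)
  show "(bdiag N d X - bdiag N d Y) $$ (i, j) = bdiag N d (\<lambda>i. X i - Y i) $$ (i, j)"
    using ij b assms(1,2)[OF b(1)] by (auto simp: bdiag_def)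
qed (auto simp: bdiag_def)

lemma mat_adjoint_bdiag:
  assumes "\<And>i. i < N \<Longrightarrow> X i \<in> carrier_mat d d"
  shows "mat_adjoint (bdiag N d X) = bdiag N d (\<lambda>i. mat_adjoint (X i))"
proof (rule eq_matI)
  fix i j assume "i < dim_row (bdiag N d (\<lambda>i. mat_adjoint (X i)))" "j < dim_col (bdiag N d (\<lambda>i. mat_adjoint (X i)))"
  then have ij: "i < N * d" "j < N * d" by (auto simp: bdiag_def)
  then have d: "0 < d" by (cases d) auto
  have b: "i div d < N" "i mod d < d" "j mod d < d"
    using ij d by (auto simp: less_mult_imp_div_less)
  show "mat_adjoint (bdiag N d X) $$ (i, j) = bdiag N d (\<lambda>i. mat_adjoint (X i)) $$ (i, j)"
    using ij b assms[OF b(1)] by (auto simp: bdiag_def)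
qed (auto simp: bdiag_def)

text \<open>The roots of the blocks form a Hermitian root of the whole, which is therefore a Gram
  matrix.\<close>

lemma psd_bdiag:
  assumes "\<And>i. i < N \<Longrightarrow> psd d (X i)" shows "psd (N * d) (bdiag N d X)"
proof -
  define Y where "Y i = op_sqrt (X i)" for i
  have Y: "psd d (Y i)" "Y i * Y i = X i" if "i < N" for i
    using op_sqrt_psd assms[OF that] by (auto simp: Y_def)
  have c: "Y i \<in> carrier_mat d d" if "i < N" for i using Y[OF that] psd_carrier by auto
  have "mat_adjoint (bdiag N d Y) = bdiag N d Y"
    using c psd_hermitian[OF Y(1)] by (subst mat_adjoint_bdiag) (auto intro!: bdiag_cong)
  then have "mat_adjoint (bdiag N d Y) * bdiag N d Y = bdiag N d X"
    using c Y by (auto simp: bdiag_mult intro: bdiag_cong)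
  then show ?thesis using psd_gram[OF bdiag_carrier, of N d Y] by simp
qed

lemma psd_bdiag_block:
  assumes "psd (N * d) (bdiag N d X)" "i < N" "X i \<in> carrier_mat d d"
  shows "psd d (X i)"
proof -
  \<comment> \<open>The isometry onto block \<open>i\<close>; compressing with it cuts the block
    out.\<close>
  define E :: "complex mat" where "E = mat (N * d) d (\<lambda>(r, c). if r = i * d + c then 1 else 0)"
  have E: "E \<in> carrier_mat (N * d) d" by (simp add: E_def)
  have ME: "bdiag N d X * E = mat (N * d) d (\<lambda>(r, c). bdiag N d X $$ (r, i * d + c))"
    by (rule eq_matI) (use assms(2) in \<open>auto simp: E_def bdiag_def scalar_prod_def atLeast0LessThan block_less
        if_distrib[of "\<lambda>x. _ * x"] cong: if_cong\<close>)
  have "mat_adjoint E * bdiag N d X * E = mat_adjoint E * mat (N * d) d (\<lambda>(r, c). bdiag N d X $$ (r, i * d + c))"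
    unfolding ME[symmetric] using E by (subst assoc_mult_mat[of _ d "N * d" _ "N * d" _ d]) auto
  also have "\<dots> = X i"
    by (rule eq_matI) (use assms(2,3) in \<open>auto simp: E_def bdiag_def scalar_prod_def atLeast0LessThan block_less
        if_distrib[of cnj] if_distrib[of "\<lambda>x. x * _"] cong: if_cong\<close>)
  finally show ?thesis using psd_congruence[OF assms(1) E] by simp
qed

section \<open>Bit vectors\<close>

text \<open>The inverse of \<open>basis_index\<close> on the numbers below \<open>2 ^ n\<close>. The
  reflection \<open>n - 1 - k\<close> is there because the first bit is the most significant, while
  \<open>set_decode\<close> counts from the least significant one.\<close>

definition bitvec :: "nat \<Rightarrow> nat \<Rightarrow> bit vec" where
  "bitvec n i = vec n (\<lambda>k. if n - 1 - k \<in> set_decode i then 1 else 0)"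

lemma bitvec_carrier [simp]: "bitvec n i \<in> carrier_vec n"
  by (simp add: bitvec_def)

lemma basis_index_set_encode:
  assumes "z \<in> carrier_vec n"
  shows "basis_index z = set_encode {k. k < n \<and> z $ (n - 1 - k) = 1}"
proof -
  have "basis_index z = (\<Sum>i\<in>{i. i < n \<and> z $ i = 1}. 2 ^ (n - 1 - i))"
    using sum.inter_filter[of "{..<n}" "\<lambda>i. 2 ^ (n - 1 - i) :: nat" "\<lambda>i. z $ i = 1"]
    unfolding basis_index_def carrier_vecD[OF assms] by simp
  also have "\<dots> = (\<Sum>k\<in>{k. k < n \<and> z $ (n - 1 - k) = 1}. 2 ^ k)"
    by (rule sum.reindex_bij_witness[of _ "\<lambda>k. n - 1 - k" "\<lambda>k. n - 1 - k"]) auto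
  finally show ?thesis by (simp add: set_encode_def)
qed

lemma basis_index_less: "z \<in> carrier_vec n \<Longrightarrow> basis_index z < 2 ^ n"
proof -
  assume z: "z \<in> carrier_vec n"
  have "basis_index z \<le> (\<Sum>k<n. 2 ^ k)"
    unfolding basis_index_set_encode[OF z] set_encode_def by (intro sum_mono2) auto
  also have "\<dots> < 2 ^ n" by (simp add: lessThan_atLeast0 sum_power2)
  finally show ?thesis .
qed

lemma bitvec_basis_index: "z \<in> carrier_vec n \<Longrightarrow> bitvec n (basis_index z) = z"
  by (rule eq_vecI) (auto simp: bitvec_def basis_index_set_encode)

lemma basis_index_bitvec: "i < 2 ^ n \<Longrightarrow> basis_index (bitvec n i) = i"
proof -
  assume i: "i < 2 ^ n"
  have "k < n" if "k \<in> set_decode i" for k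
  proof (rule ccontr)
    assume "\<not> k < n"
    then have "2 ^ n \<le> (2 :: nat) ^ k" by simp
    then have "i div 2 ^ k = 0" using i by (intro div_less) linarith
    then show False using that by (simp add: set_decode_def)
  qed
  then have "{k. k < n \<and> bitvec n i $ (n - 1 - k) = 1} = set_decode i"
    by (force simp: bitvec_def split: if_splits)
  then show ?thesis by (simp add: basis_index_set_encode[of _ n])
qed

lemma bij_betw_bitvec: "bij_betw (bitvec n) {..<2 ^ n} (carrier_vec n)"
  by (rule bij_betwI[of _ _ _ basis_index]) (auto simp: basis_index_less bitvec_basis_index basis_index_bitvec)

lemma finite_bit_vecs [simp]: "finite (carrier_vec n :: bit vec set)"
  using bij_betw_finite[OF bij_betw_bitvec] by simp

lemma card_bit_vecs: "card (carrier_vec n :: bit vec set) = 2 ^ n"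
  using bij_betw_same_card[OF bij_betw_bitvec, of n] by simp

section \<open>Classical-quantum states\<close>

text \<open>The projection onto \<open>z\<close> places \<open>\<rho> z\<close> in block
  \<open>basis_index z\<close>, and \<open>bitvec\<close> turns the sum over strings into one over
  block numbers.\<close>

lemma cq_state_bdiag:
  assumes "\<And>z. z \<in> carrier_vec n \<Longrightarrow> \<rho> z \<in> carrier_mat d d"
  shows "cq_state n d \<rho> = bdiag (2 ^ n) d (\<lambda>i. \<rho> (bitvec n i))"
proof (rule eq_matI)
  fix i j assume "i < dim_row (bdiag (2 ^ n) d (\<lambda>i. \<rho> (bitvec n i)))" "j < dim_col (bdiag (2 ^ n) d (\<lambda>i. \<rho> (bitvec n i)))"
  then have ij: "i < 2 ^ n * d" "j < 2 ^ n * d" by (auto simp: bdiag_def)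
  have b: "i div d < 2 ^ n" "j div d < 2 ^ n"
    using ij by (auto simp: less_mult_imp_div_less)
  have "cq_state n d \<rho> $$ (i, j) = (\<Sum>z\<in>carrier_vec n. tensor_op (basis_proj z) (\<rho> z) $$ (i, j))"
    using ij by (simp add: cq_state_def op_sum_def)
  also have "\<dots> = (\<Sum>z\<in>carrier_vec n. if i div d = basis_index z \<and> j div d = basis_index z
      then \<rho> z $$ (i mod d, j mod d) else 0)"
  proof (intro sum.cong refl)
    fix z :: "bit vec" assume "z \<in> carrier_vec n"
    then have "dim_row (\<rho> z) = d" "dim_col (\<rho> z) = d" "dim_vec z = n" using assms by auto
    then show "tensor_op (basis_proj z) (\<rho> z) $$ (i, j) = (if i div d = basis_index z \<and> j div d = basis_index z
        then \<rho> z $$ (i mod d, j mod d) else 0)"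
      using ij b by (simp add: tensor_op_def basis_proj_def)
  qed
  also have "\<dots> = (\<Sum>k<2 ^ n. if i div d = basis_index (bitvec n k) \<and> j div d = basis_index (bitvec n k)
      then \<rho> (bitvec n k) $$ (i mod d, j mod d) else 0)"
    by (rule sum.reindex_bij_betw[OF bij_betw_bitvec, symmetric])
  also have "\<dots> = (\<Sum>k<2 ^ n. if k = i div d then (if i div d = j div d
      then \<rho> (bitvec n k) $$ (i mod d, j mod d) else 0) else 0)"
    by (intro sum.cong) (auto simp: basis_index_bitvec)
  also have "\<dots> = bdiag (2 ^ n) d (\<lambda>i. \<rho> (bitvec n i)) $$ (i, j)"
    using ij b by (simp add: bdiag_def)
  finally show "cq_state n d \<rho> $$ (i, j) = bdiag (2 ^ n) d (\<lambda>i. \<rho> (bitvec n i)) $$ (i, j)" .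
qed (auto simp: bdiag_def cq_state_def op_sum_def)

lemma tensor_one_bdiag:
  assumes "\<sigma> \<in> carrier_mat d d"
  shows "tensor_op (c \<cdot>\<^sub>m 1\<^sub>m N) \<sigma> = bdiag N d (\<lambda>_. c \<cdot>\<^sub>m \<sigma>)"
proof (rule eq_matI)
  fix i j assume "i < dim_row (bdiag N d (\<lambda>_. c \<cdot>\<^sub>m \<sigma>))" "j < dim_col (bdiag N d (\<lambda>_. c \<cdot>\<^sub>m \<sigma>))"
  then have ij: "i < N * d" "j < N * d" by (auto simp: bdiag_def)
  then have d: "0 < d" by (cases d) auto
  have b: "i div d < N" "j div d < N" "i mod d < d" "j mod d < d"
    using ij d by (auto simp: less_mult_imp_div_less)
  show "tensor_op (c \<cdot>\<^sub>m 1\<^sub>m N) \<sigma> $$ (i, j) = bdiag N d (\<lambda>_. c \<cdot>\<^sub>m \<sigma>) $$ (i, j)"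
    using ij b assms by (auto simp: tensor_op_def bdiag_def)
qed (use assms in \<open>auto simp: tensor_op_def bdiag_def\<close>)

lemma tr_cq_state:
  assumes "\<And>z. z \<in> carrier_vec n \<Longrightarrow> \<rho> z \<in> carrier_mat d d"
  shows "tr (cq_state n d \<rho>) = (\<Sum>z\<in>carrier_vec n. tr (\<rho> z))"
proof -
  have "tr (cq_state n d \<rho>) = (\<Sum>i<2 ^ n. tr (\<rho> (bitvec n i)))"
    using assms by (simp add: cq_state_bdiag tr_bdiag)
  also have "\<dots> = (\<Sum>z\<in>carrier_vec n. tr (\<rho> z))"
    by (rule sum.reindex_bij_betw[OF bij_betw_bitvec])
  finally show ?thesis .
qed

lemma psd_cq_state_iff:
  assumes "\<And>z. z \<in> carrier_vec n \<Longrightarrow> \<rho> z \<in> carrier_mat d d"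
  shows "psd (2 ^ n * d) (cq_state n d \<rho>) \<longleftrightarrow> (\<forall>z\<in>carrier_vec n. psd d (\<rho> z))"
proof safe
  fix z :: "bit vec" assume *: "psd (2 ^ n * d) (cq_state n d \<rho>)" and z: "z \<in> carrier_vec n"
  have "psd (2 ^ n * d) (bdiag (2 ^ n) d (\<lambda>i. \<rho> (bitvec n i)))"
    using * assms by (simp add: cq_state_bdiag)
  then have "psd d (\<rho> (bitvec n (basis_index z)))"
    by (rule psd_bdiag_block) (use z assms basis_index_less in auto)
  then show "psd d (\<rho> z)" using z by (simp add: bitvec_basis_index)
next
  assume "\<forall>z\<in>carrier_vec n. psd d (\<rho> z)"
  then show "psd (2 ^ n * d) (cq_state n d \<rho>)"
    using assms by (simp add: cq_state_bdiag psd_bdiag)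
qed

text \<open>The difference of the two sides is again a classical-quantum state, with blocks
  \<open>\<sigma> - \<rho> z\<close>.\<close>

lemma loewner_le_cq_state_iff:
  assumes "\<And>z. z \<in> carrier_vec n \<Longrightarrow> \<rho> z \<in> carrier_mat d d" "\<sigma> \<in> carrier_mat d d"
  shows "loewner_le (2 ^ n * d) (cq_state n d \<rho>) (tensor_op (1\<^sub>m (2 ^ n)) \<sigma>)
    \<longleftrightarrow> (\<forall>z\<in>carrier_vec n. psd d (\<sigma> - \<rho> z))"
proof -
  have "1 \<cdot>\<^sub>m A = A" for A :: "complex mat" by (rule eq_matI) auto
  then have T: "tensor_op (1\<^sub>m (2 ^ n)) \<sigma> = bdiag (2 ^ n) d (\<lambda>_. \<sigma>)"
    using tensor_one_bdiag[OF assms(2), of 1] by simp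
  have "bdiag (2 ^ n) d (\<lambda>_. \<sigma>) - cq_state n d \<rho> = cq_state n d (\<lambda>z. \<sigma> - \<rho> z)"
    using assms by (simp add: cq_state_bdiag bdiag_minus minus_carrier_mat)
  moreover have "cq_state n d \<rho> \<in> carrier_mat (2 ^ n * d) (2 ^ n * d)"
    by (simp add: cq_state_def op_sum_def)
  ultimately show ?thesis
    using assms by (simp add: loewner_le_def T psd_cq_state_iff minus_carrier_mat)
qed

section \<open>Sums of operators\<close>

lemma op_sum_carrier [simp]: "op_sum d X S \<in> carrier_mat d d"
  by (simp add: op_sum_def)

lemma tr_mult_op_sum:
  assumes "W \<in> carrier_mat d d" "\<And>x. x \<in> S \<Longrightarrow> X x \<in> carrier_mat d d"
  shows "tr (W * op_sum d X S) = (\<Sum>x\<in>S. tr (W * X x))"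
proof -
  have "tr (W * op_sum d X S) = (\<Sum>i<d. \<Sum>j<d. \<Sum>x\<in>S. Re (W $$ (i, j) * X x $$ (j, i)))"
    by (subst tr_mult[OF assms(1) op_sum_carrier])
      (intro sum.cong, auto simp: op_sum_def sum_distrib_left simp del: times_complex.sel)
  also have "\<dots> = (\<Sum>x\<in>S. \<Sum>i<d. \<Sum>j<d. Re (W $$ (i, j) * X x $$ (j, i)))"
    by (subst (2) sum.swap) (subst sum.swap, simp)
  also have "\<dots> = (\<Sum>x\<in>S. tr (W * X x))"
    by (intro sum.cong) (auto simp: tr_mult[OF assms(1) assms(2)])
  finally show ?thesis .
qed

lemma tr_op_sum:
  assumes "\<And>x. x \<in> S \<Longrightarrow> X x \<in> carrier_mat d d"
  shows "tr (op_sum d X S) = (\<Sum>x\<in>S. tr (X x))"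
  using tr_mult_op_sum[of "1\<^sub>m d" d S X] assms
  by (simp add: left_mult_one_mat[of _ d d] cong: sum.cong)

lemma psd_op_sum:
  assumes "finite S" "\<And>x. x \<in> S \<Longrightarrow> psd d (X x)" shows "psd d (op_sum d X S)"
  using assms
proof (induction S rule: finite_induct)
  case empty
  have "op_sum d X {} = 0\<^sub>m d d" by (rule eq_matI) (auto simp: op_sum_def)
  then show ?case by simp
next
  case (insert x S)
  have "op_sum d X (insert x S) = X x + op_sum d X S"
    by (rule eq_matI) (use insert psd_carrier[of d "X x"] in \<open>auto simp: op_sum_def\<close>)
  then show ?case using insert by (auto intro: psd_add)
qed

section \<open>Characters of bit vectors\<close>

text \<open>The nontrivial additive character of the field with two elements. The maps sending
  \<open>z\<close> to \<open>chi (x \<bullet> z)\<close> are the characters of the group of bit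
  strings; being real, they need no conjugation.\<close>

definition chi :: "bit \<Rightarrow> real" where
  "chi b = (if b = 1 then -1 else 1)"

lemma chi_0 [simp]: "chi 0 = 1" and chi_1 [simp]: "chi 1 = -1"
  by (simp_all add: chi_def)

lemma chi_add: "chi (a + b) = chi a * chi b"
  by (cases a; cases b) (simp_all add: chi_def)

lemma bit_vec_add_self: "(x :: bit vec) \<in> carrier_vec m \<Longrightarrow> x + x = 0\<^sub>v m"
  by (rule eq_vecI) auto

lemma bit_vec_add_eq_0_iff:
  assumes "(x :: bit vec) \<in> carrier_vec m" "y \<in> carrier_vec m"
  shows "x + y = 0\<^sub>v m \<longleftrightarrow> x = y"
proof
  assume "x + y = 0\<^sub>v m"
  then have "x $ i + y $ i = 0" if "i < m" for i
    using that assms by (metis carrier_vecD index_add_vec(1) index_zero_vec(1))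
  moreover have "a = b" if "a + b = 0" for a b :: bit
    using that by (cases a; cases b) auto
  ultimately have "x $ i = y $ i" if "i < m" for i
    using that by blast
  then show "x = y" using assms by (intro eq_vecI) auto
qed (use assms bit_vec_add_self in auto)

text \<open>If \<open>w\<close> has a 1 at position \<open>i\<close>, translation of
  \<open>y\<close> by the unit vector at \<open>i\<close> flips the sign of every term, so the sum
  equals its own negative.\<close>

lemma sum_chi:
  assumes w: "w \<in> carrier_vec m"
  shows "(\<Sum>y\<in>carrier_vec m. chi (y \<bullet> w)) = (if w = 0\<^sub>v m then 2 ^ m else 0)"
proof (cases "w = 0\<^sub>v m")
  case True
  then show ?thesis by (simp add: card_bit_vecs)
next
  case False
  then obtain i where i: "i < m" "w $ i = 1"
    using w by (metis bit_not_zero_iff carrier_vecD eq_vecI index_zero_vec(1,2))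
  let ?e = "unit_vec m i :: bit vec"
  have bij: "bij_betw (\<lambda>y. y + ?e) (carrier_vec m) (carrier_vec m)"
    by (rule bij_betwI[of _ _ _ "\<lambda>y. y + ?e"])
      (auto simp: bit_vec_add_self[of ?e m] assoc_add_vec[of _ m ?e ?e])
  have "(\<Sum>y\<in>carrier_vec m. chi (y \<bullet> w)) = (\<Sum>y\<in>carrier_vec m. chi ((y + ?e) \<bullet> w))"
    by (rule sum.reindex_bij_betw[OF bij, symmetric])
  also have "\<dots> = (\<Sum>y\<in>carrier_vec m. - chi (y \<bullet> w))"
    using i w by (intro sum.cong) (auto simp: add_scalar_prod_distrib[of _ m] chi_add)
  finally show ?thesis using False by (simp add: sum_negf)
qed

lemma transpose_scalar_prod:
  fixes f :: "'a :: comm_ring mat"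
  assumes "f \<in> carrier_mat m n" "y \<in> carrier_vec m" "z \<in> carrier_vec n"
  shows "(transpose_mat f *\<^sub>v y) \<bullet> z = y \<bullet> (f *\<^sub>v z)"
proof -
  have "(transpose_mat f *\<^sub>v y) \<bullet> z = (\<Sum>i<n. \<Sum>j<m. f $$ (j, i) * y $ j * z $ i)"
    using assms by (auto simp: scalar_prod_def sum_distrib_right atLeast0LessThan intro!: sum.cong)
  also have "\<dots> = (\<Sum>j<m. \<Sum>i<n. f $$ (j, i) * y $ j * z $ i)"
    by (rule sum.swap)
  also have "\<dots> = y \<bullet> (f *\<^sub>v z)"
    using assms by (auto simp: scalar_prod_def sum_distrib_left atLeast0LessThan mult_ac intro!: sum.cong)
  finally show ?thesis .
qed

text \<open>If \<open>b z z' = B (u z) (u z')\<close> for a bilinear form \<open>B\<close>, this is \<open>B\<close> on the Fourier coefficient of \<open>u\<close> at \<open>x\<close>.\<close>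

definition power_spectrum :: "nat \<Rightarrow> (bit vec \<Rightarrow> bit vec \<Rightarrow> real) \<Rightarrow> bit vec \<Rightarrow> real" where
  "power_spectrum n b x = (\<Sum>z\<in>carrier_vec n. \<Sum>z'\<in>carrier_vec n. chi (x \<bullet> z) * chi (x \<bullet> z') * b z z')"

text \<open>Poisson summation over the row space of \<open>f\<close>.\<close>

lemma sum_power_spectrum_row_space:
  assumes f: "f \<in> carrier_mat m n"
  shows "(\<Sum>y\<in>carrier_vec m. power_spectrum n b (transpose_mat f *\<^sub>v y))
    = 2 ^ m * (\<Sum>k\<in>carrier_vec m. \<Sum>z\<in>{z \<in> carrier_vec n. f *\<^sub>v z = k}.
        \<Sum>z'\<in>{z \<in> carrier_vec n. f *\<^sub>v z = k}. b z z')"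
proof -
  let ?C = "carrier_vec n :: bit vec set" and ?D = "carrier_vec m :: bit vec set"
  have fC: "f *\<^sub>v z \<in> ?D" if "z \<in> ?C" for z using f that by simp
  have "(\<Sum>y\<in>?D. power_spectrum n b (transpose_mat f *\<^sub>v y))
    = (\<Sum>y\<in>?D. \<Sum>z\<in>?C. \<Sum>z'\<in>?C. chi (y \<bullet> (f *\<^sub>v z + f *\<^sub>v z')) * b z z')"
    unfolding power_spectrum_def
  proof (intro sum.cong refl)
    fix y z z' :: "bit vec" assume *: "y \<in> ?D" "z \<in> ?C" "z' \<in> ?C"
    have "chi (y \<bullet> (f *\<^sub>v z + f *\<^sub>v z')) = chi (y \<bullet> (f *\<^sub>v z)) * chi (y \<bullet> (f *\<^sub>v z'))"
      using * fC by (subst scalar_prod_add_distrib[of _ m]) (auto intro: chi_add)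
    then show "chi ((transpose_mat f *\<^sub>v y) \<bullet> z) * chi ((transpose_mat f *\<^sub>v y) \<bullet> z') * b z z'
        = chi (y \<bullet> (f *\<^sub>v z + f *\<^sub>v z')) * b z z'"
      using * by (simp only: transpose_scalar_prod[OF f])
  qed
  also have "\<dots> = (\<Sum>z\<in>?C. \<Sum>y\<in>?D. \<Sum>z'\<in>?C. chi (y \<bullet> (f *\<^sub>v z + f *\<^sub>v z')) * b z z')"
    by (rule sum.swap)
  also have "\<dots> = (\<Sum>z\<in>?C. \<Sum>z'\<in>?C. \<Sum>y\<in>?D. chi (y \<bullet> (f *\<^sub>v z + f *\<^sub>v z')) * b z z')"
    by (rule sum.cong[OF refl]) (rule sum.swap)
  \<comment> \<open>In characteristic 2 the vector \<open>f z + f z'\<close> vanishes exactly when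
    \<open>z\<close> and \<open>z'\<close> have the same hash; otherwise the character sum over
    \<open>y\<close> is 0.\<close>
  also have "\<dots> = (\<Sum>z\<in>?C. \<Sum>z'\<in>?C. if f *\<^sub>v z = f *\<^sub>v z' then 2 ^ m * b z z' else 0)"
  proof (intro sum.cong refl)
    fix z z' assume *: "z \<in> ?C" "z' \<in> ?C"
    have "f *\<^sub>v z + f *\<^sub>v z' \<in> ?D" using * fC by simp
    then show "(\<Sum>y\<in>?D. chi (y \<bullet> (f *\<^sub>v z + f *\<^sub>v z')) * b z z') = (if f *\<^sub>v z = f *\<^sub>v z' then 2 ^ m * b z z' else 0)"
      using fC[OF *(1)] fC[OF *(2)]
      by (simp add: sum_distrib_right[symmetric] sum_chi bit_vec_add_eq_0_iff)
  qed
  \<comment> \<open>The common hash value becomes a summation index \<open>k\<close>, which turns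
    colliding pairs into pairs inside one fibre of \<open>f\<close>.\<close>
  also have "\<dots> = (\<Sum>z\<in>?C. \<Sum>k\<in>?D. if f *\<^sub>v z = k then \<Sum>z'\<in>?C. if f *\<^sub>v z' = k then 2 ^ m * b z z' else 0 else 0)"
  proof (rule sum.cong[OF refl])
    fix z assume z: "z \<in> ?C"
    have "(\<Sum>k\<in>?D. if f *\<^sub>v z = k then \<Sum>z'\<in>?C. if f *\<^sub>v z' = k then 2 ^ m * b z z' else 0 else 0)
      = (\<Sum>z'\<in>?C. if f *\<^sub>v z' = f *\<^sub>v z then 2 ^ m * b z z' else 0)"
      using fC[OF z] by simp
    also have "\<dots> = (\<Sum>z'\<in>?C. if f *\<^sub>v z = f *\<^sub>v z' then 2 ^ m * b z z' else 0)"
      by (rule sum.cong) auto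
    finally show "(\<Sum>z'\<in>?C. if f *\<^sub>v z = f *\<^sub>v z' then 2 ^ m * b z z' else 0)
      = (\<Sum>k\<in>?D. if f *\<^sub>v z = k then \<Sum>z'\<in>?C. if f *\<^sub>v z' = k then 2 ^ m * b z z' else 0 else 0)" ..
  qed
  also have "\<dots> = (\<Sum>k\<in>?D. \<Sum>z\<in>?C. if f *\<^sub>v z = k then \<Sum>z'\<in>?C. if f *\<^sub>v z' = k then 2 ^ m * b z z' else 0 else 0)"
    by (rule sum.swap)
  also have "\<dots> = 2 ^ m * (\<Sum>k\<in>?D. \<Sum>z\<in>{z \<in> ?C. f *\<^sub>v z = k}. \<Sum>z'\<in>{z \<in> ?C. f *\<^sub>v z = k}. b z z')"
    by (simp add: sum.inter_filter sum_distrib_left if_distrib cong: if_cong)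
  finally show ?thesis .
qed

text \<open>Parseval's identity, as the case of the identity matrix: its row space is everything and
  its fibres are singletons.\<close>

lemma sum_power_spectrum:
  "(\<Sum>x\<in>carrier_vec n. power_spectrum n b x) = 2 ^ n * (\<Sum>z\<in>carrier_vec n. b z z)"
proof -
  have "(\<Sum>x\<in>carrier_vec n. power_spectrum n b x)
    = (\<Sum>y\<in>carrier_vec n. power_spectrum n b (transpose_mat (1\<^sub>m n) *\<^sub>v y))"
    by (intro sum.cong) auto
  also have "\<dots> = 2 ^ n * (\<Sum>k\<in>carrier_vec n. \<Sum>z\<in>{z \<in> carrier_vec n. 1\<^sub>m n *\<^sub>v z = k}.
        \<Sum>z'\<in>{z \<in> carrier_vec n. 1\<^sub>m n *\<^sub>v z = k}. b z z')"
    by (rule sum_power_spectrum_row_space) simp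
  also have "\<dots> = 2 ^ n * (\<Sum>k\<in>carrier_vec n. b k k)"
  proof -
    have "{z \<in> carrier_vec n. 1\<^sub>m n *\<^sub>v z = k} = {k}" if "k \<in> carrier_vec n" for k :: "bit vec"
      using that by auto
    then show ?thesis by simp
  qed
  finally show ?thesis .
qed

section \<open>Dual functions\<close>

text \<open>\<open>y\<close> is orthogonal to every column of \<open>f\<close>. A maximal
  independent set of columns has \<open>n\<close> elements and thus spans the space, so
  \<open>y\<close> is orthogonal to the unit vectors too.\<close>

lemma (in vec_space) full_row_rank_transpose_kernel:
  assumes f: "f \<in> carrier_mat n nc" "rank f = n" and y: "y \<in> carrier_vec n"
    and fy: "transpose_mat f *\<^sub>v y = 0\<^sub>v nc"
  shows "y = 0\<^sub>v n"
proof -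
  have cols: "set (cols f) \<subseteq> carrier_vec n" using cols_dim[of f] f(1) by auto
  obtain S where S: "maximal S (\<lambda>T. T \<subseteq> set (cols f) \<and> lin_indpt T)"
    using maximal_exists[of "\<lambda>T. T \<subseteq> set (cols f) \<and> lin_indpt T" "card (set (cols f))" "{}"]
    by (meson List.finite_set card_mono empty_iff empty_subsetI finite_lin_indpt2 rev_finite_subset)
  have card: "card S = n" using rank_card_indpt[OF f(1) S] f(2) by simp
  have sub: "S \<subseteq> set (cols f)" "lin_indpt S" using S by (auto simp: maximal_def)
  have "basis S"
  proof (rule dim_li_is_basis[OF _ _ _ sub(2)])
    show "finite S" using finite_subset[OF sub(1)] by simp
    show "S \<subseteq> carrier_vec n" using sub(1) cols by simp
    show "dim \<le> card S" unfolding card dim_is_n ..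
  qed simp
  then have span: "span S = carrier_vec n" unfolding basis_def by simp
  define W where "W = {v \<in> carrier_vec n. y \<bullet> v = 0}"
  have "S \<subseteq> W"
  proof
    fix v assume "v \<in> S"
    then obtain j where j: "j < nc" "v = col f j"
      using sub(1) f(1) by (metis carrier_matD(2) cols_length cols_nth in_set_conv_nth subsetD)
    have "(transpose_mat f *\<^sub>v y) $ j = v \<bullet> y" using j f(1) y by simp
    then have "v \<bullet> y = 0" using fy j by simp
    then show "v \<in> W" using j f(1) y comm_scalar_prod[of v n y] by (auto simp: W_def)
  qed
  moreover have "submodule class_ring W V"
    using y module_axioms
    by (intro submodule.intro) (auto simp: W_def scalar_prod_add_distrib[of _ n])
  ultimately have "span S \<subseteq> W" by (rule span_is_subset)
  then have all: "y \<bullet> v = 0" if "v \<in> carrier_vec n" for v using span that by (auto simp: W_def)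
  show ?thesis
  proof (rule eq_vecI)
    fix i assume "i < dim_vec (0\<^sub>v n :: 'a vec)"
    then show "y $ i = 0\<^sub>v n $ i" using all[of "unit_vec n i"] y by simp
  qed (use y in simp)
qed

lemma linear_surj_transpose_kernel:
  assumes "f \<in> linear_surj m n" "y \<in> carrier_vec m" "transpose_mat f *\<^sub>v y = 0\<^sub>v n"
  shows "y = 0\<^sub>v m"
  using assms vec_space.full_row_rank_transpose_kernel[of f m n y] by (simp add: linear_surj_def)

lemma zero_mat_mult_vec: "v \<in> carrier_vec m \<Longrightarrow> 0\<^sub>m n m *\<^sub>v v = (0\<^sub>v n :: 'a :: comm_ring_1 vec)"
  by (rule eq_vecI) auto

text \<open>Duality transposed: \<open>g * transpose_mat f\<close> is the transpose of
  \<open>f * transpose_mat g = 0\<close>.\<close>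

lemma row_space_kernel_dual:
  assumes "dual_fun m n f g" "y \<in> carrier_vec m"
  shows "g *\<^sub>v (transpose_mat f *\<^sub>v y) = 0\<^sub>v (n - m)"
proof -
  have f: "f \<in> carrier_mat m n" and g: "g \<in> carrier_mat (n - m) n"
    using assms by (auto simp: dual_fun_def linear_surj_def)
  have "g * transpose_mat f = transpose_mat (f * transpose_mat g)"
    using f g by (subst transpose_mult[of _ m n _ "n - m"]) auto
  also have "\<dots> = 0\<^sub>m (n - m) m" using assms by (auto simp: dual_fun_def)
  finally have "(g * transpose_mat f) *\<^sub>v y = 0\<^sub>v (n - m)" using assms(2) by (simp add: zero_mat_mult_vec)
  then show ?thesis using f g assms(2) by (simp add: assoc_mult_mat_vec[of _ "n - m" n _ m])
qed

text \<open>The transpose of \<open>f\<close> is injective, so the left side runs once over the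
  nonzero vectors of the row space. These lie in the kernel of \<open>g\<close>, and nonnegativity
  of \<open>c\<close> makes this inclusion enough.\<close>

lemma sum_row_space_le:
  fixes c :: "bit vec \<Rightarrow> real"
  assumes d: "dual_fun m n f g" and c: "\<And>x. x \<in> carrier_vec n \<Longrightarrow> 0 \<le> c x"
  shows "(\<Sum>y\<in>carrier_vec m - {0\<^sub>v m}. c (transpose_mat f *\<^sub>v y))
    \<le> (\<Sum>x\<in>carrier_vec n - {0\<^sub>v n}. if g *\<^sub>v x = 0\<^sub>v (n - m) then c x else 0)"
proof -
  let ?t = "\<lambda>y. transpose_mat f *\<^sub>v y"
  have f: "f \<in> carrier_mat m n" "f \<in> linear_surj m n"
    using d by (auto simp: dual_fun_def linear_surj_def)
  have inj: "inj_on ?t (carrier_vec m - {0\<^sub>v m})"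
  proof (rule inj_onI)
    fix y y' assume *: "y \<in> carrier_vec m - {0\<^sub>v m}" "y' \<in> carrier_vec m - {0\<^sub>v m}" "?t y = ?t y'"
    \<comment> \<open>Over the field with two elements, \<open>y + y'\<close> is the
      difference.\<close>
    have "?t (y + y') = ?t y + ?t y'"
      using * f by (intro mult_add_distrib_mat_vec[of _ n m]) auto
    also have "\<dots> = 0\<^sub>v n" unfolding *(3) using f * by (intro bit_vec_add_self) auto
    finally have "y + y' = 0\<^sub>v m" using linear_surj_transpose_kernel[OF f(2)] * by auto
    then show "y = y'" using * bit_vec_add_eq_0_iff by auto
  qed
  have "(\<Sum>y\<in>carrier_vec m - {0\<^sub>v m}. c (?t y)) = (\<Sum>x\<in>?t ` (carrier_vec m - {0\<^sub>v m}). c x)"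
    using inj by (simp add: sum.reindex)
  also have "\<dots> \<le> (\<Sum>x\<in>{x \<in> carrier_vec n - {0\<^sub>v n}. g *\<^sub>v x = 0\<^sub>v (n - m)}. c x)"
    using f c linear_surj_transpose_kernel[OF f(2)] row_space_kernel_dual[OF d]
    by (intro sum_mono2) auto
  also have "\<dots> = (\<Sum>x\<in>carrier_vec n - {0\<^sub>v n}. if g *\<^sub>v x = 0\<^sub>v (n - m) then c x else 0)"
    by (rule sum.inter_filter) simp
  finally show ?thesis .
qed

section \<open>The fidelity bound for a single hash function\<close>

text \<open>The form \<open>tr (V * A * V * B)\<close> is symmetric by cyclicity of the trace, so
  linearity in the second argument gives both.\<close>

lemma tr_sandwich_op_sum:
  assumes V: "V \<in> carrier_mat d d"
    and X: "\<And>x. x \<in> S \<Longrightarrow> X x \<in> carrier_mat d d" and Y: "\<And>y. y \<in> T \<Longrightarrow> Y y \<in> carrier_mat d d"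
  shows "tr (V * op_sum d X S * V * op_sum d Y T) = (\<Sum>x\<in>S. \<Sum>y\<in>T. tr (V * X x * V * Y y))"
proof -
  have swap: "tr (V * A * V * B) = tr (V * B * V * A)"
    if "A \<in> carrier_mat d d" "B \<in> carrier_mat d d" for A B
    using V that tr_mult_comm[of "V * A" d d "V * B"] by (simp add: assoc_mult_mat[of _ d d _ d _ d])
  have "tr (V * op_sum d X S * V * op_sum d Y T) = (\<Sum>y\<in>T. tr (V * op_sum d X S * V * Y y))"
    by (rule tr_mult_op_sum) (use V Y op_sum_carrier[of d X S] in auto)
  also have "\<dots> = (\<Sum>y\<in>T. \<Sum>x\<in>S. tr (V * X x * V * Y y))"
  proof (rule sum.cong[OF refl])
    fix y assume y: "y \<in> T"
    have "tr (V * op_sum d X S * V * Y y) = tr (V * Y y * V * op_sum d X S)"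
      using Y[OF y] by (intro swap) auto
    also have "\<dots> = (\<Sum>x\<in>S. tr (V * Y y * V * X x))"
      by (rule tr_mult_op_sum) (use V Y[OF y] X in auto)
    also have "\<dots> = (\<Sum>x\<in>S. tr (V * X x * V * Y y))"
      using Y[OF y] X by (intro sum.cong) (auto intro: swap)
    finally show "tr (V * op_sum d X S * V * Y y) = (\<Sum>x\<in>S. tr (V * X x * V * Y y))" .
  qed
  also have "\<dots> = (\<Sum>x\<in>S. \<Sum>y\<in>T. tr (V * X x * V * Y y))"
    by (rule sum.swap)
  finally show ?thesis .
qed

lemma power_spectrum_0:
  assumes "V \<in> carrier_mat d d" "\<And>z. z \<in> carrier_vec n \<Longrightarrow> \<rho> z \<in> carrier_mat d d"
  shows "power_spectrum n (\<lambda>z z'. tr (V * \<rho> z * V * \<rho> z')) (0\<^sub>v n)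
    = tr (V * op_sum d \<rho> (carrier_vec n) * V * op_sum d \<rho> (carrier_vec n))"
  using assms by (simp add: power_spectrum_def tr_sandwich_op_sum)

text \<open>The value is \<open>tr (V * H * V * H)\<close> for the Fourier coefficient
  \<open>H\<close> at \<open>x\<close>. \<open>H\<close> is in general indefinite, but it is
  Hermitian because the characters are real, so \<open>H * V * H\<close> is positive
  semidefinite.\<close>

lemma power_spectrum_nonneg:
  assumes V: "psd d V" and \<rho>: "\<And>z. z \<in> carrier_vec n \<Longrightarrow> psd d (\<rho> z)"
  shows "0 \<le> power_spectrum n (\<lambda>z z'. tr (V * \<rho> z * V * \<rho> z')) x"
proof -
  define c where "c z = complex_of_real (chi (x \<bullet> z))" for z
  define H where "H = op_sum d (\<lambda>z. c z \<cdot>\<^sub>m \<rho> z) (carrier_vec n)"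
  have \<rho>c: "\<rho> z \<in> carrier_mat d d" if "z \<in> carrier_vec n" for z
    using \<rho>[OF that] psd_carrier by auto
  have Vc: "V \<in> carrier_mat d d" using V psd_carrier by auto
  have H: "H \<in> carrier_mat d d" by (simp add: H_def)
  have "mat_adjoint H = H"
  proof (rule eq_matI)
    fix i j assume "i < dim_row H" "j < dim_col H"
    then have ij: "i < d" "j < d" using H by auto
    have "cnj (\<rho> z $$ (j, i)) = \<rho> z $$ (i, j)" if "z \<in> carrier_vec n" for z
      using index_mat_adjoint[of i "\<rho> z" j] psd_hermitian[OF \<rho>[OF that]] \<rho>c[OF that] ij by simp
    moreover have "dim_row (\<rho> z) = d" "dim_col (\<rho> z) = d" if "z \<in> carrier_vec n" for z
      using \<rho>c[OF that] by auto
    ultimately show "mat_adjoint H $$ (i, j) = H $$ (i, j)"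
      using ij by (auto simp: H_def op_sum_def c_def intro!: sum.cong)
  qed (use H in auto)
  then have "psd d (H * V * H)" using psd_congruence[OF V H] by simp
  then have "0 \<le> tr (V * (H * V * H))" by (rule tr_psd_mult_nonneg[OF V])
  also have "V * (H * V * H) = V * H * V * H" using Vc H by (simp add: assoc_mult_mat[of _ d d _ d _ d])
  also have "tr (V * H * V * H)
      = (\<Sum>z\<in>carrier_vec n. \<Sum>z'\<in>carrier_vec n. tr (V * (c z \<cdot>\<^sub>m \<rho> z) * V * (c z' \<cdot>\<^sub>m \<rho> z')))"
    unfolding H_def using Vc \<rho>c by (intro tr_sandwich_op_sum) auto
  also have "\<dots> = power_spectrum n (\<lambda>z z'. tr (V * \<rho> z * V * \<rho> z')) x"
    unfolding power_spectrum_def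
  proof (intro sum.cong refl)
    fix z z' :: "bit vec" assume zz: "z \<in> carrier_vec n" "z' \<in> carrier_vec n"
    have eq: "V * (c z \<cdot>\<^sub>m \<rho> z) * V * (c z' \<cdot>\<^sub>m \<rho> z')
        = complex_of_real (chi (x \<bullet> z) * chi (x \<bullet> z')) \<cdot>\<^sub>m (V * \<rho> z * V * \<rho> z')"
      using Vc \<rho>c[OF zz(1)] \<rho>c[OF zz(2)]
      by (simp add: c_def mult_smult_distrib[of _ d d _ d] mult_smult_assoc_mat[of _ d d _ d] smult_smult_mat mult.commute)
    show "tr (V * (c z \<cdot>\<^sub>m \<rho> z) * V * (c z' \<cdot>\<^sub>m \<rho> z')) = chi (x \<bullet> z) * chi (x \<bullet> z') * tr (V * \<rho> z * V * \<rho> z')"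
      unfolding eq by (rule tr_smult[of _ d]) (use Vc \<rho>c[OF zz(1)] \<rho>c[OF zz(2)] in auto)
  qed
  finally show ?thesis .
qed

section \<open>From the fidelity to \<open>exp2\<close> of \<open>H_max\<close>\<close>

lemma elog2_mono: "x \<le> y \<Longrightarrow> elog2 x \<le> elog2 y"
  by (auto simp: elog2_def)

text \<open>The upper bound on the trace norm keeps the supremum away from \<open>\<infinity>\<close>, where \<open>exp2\<close> is arbitrary.\<close>

lemma exp2_H_max_ge:
  assumes R: "psd (2 ^ m * d) R" and \<sigma>: "normalized_state d \<sigma>"
  shows "(trace_norm (op_sqrt R * op_sqrt (tensor_op (complex_of_real (1 / 2 ^ m) \<cdot>\<^sub>m 1\<^sub>m (2 ^ m)) \<sigma>)))\<^sup>2
    \<le> exp2 (H_max m d R - ereal (real m))"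
proof -
  define c where "c = complex_of_real (1 / 2 ^ m)"
  define F where "F \<sigma> = (trace_norm (op_sqrt R * op_sqrt (tensor_op (c \<cdot>\<^sub>m 1\<^sub>m (2 ^ m)) \<sigma>)))\<^sup>2" for \<sigma>
  have F_le: "F \<tau> \<le> real (2 ^ m * d) * tr R" if \<tau>: "normalized_state d \<tau>" for \<tau>
  proof -
    have p: "psd d \<tau>" "\<tau> \<in> carrier_mat d d" "tr \<tau> = 1"
      using \<tau> psd_carrier by (auto simp: normalized_state_def)
    let ?T = "tensor_op (c \<cdot>\<^sub>m 1\<^sub>m (2 ^ m)) \<tau>"
    have T: "?T = bdiag (2 ^ m) d (\<lambda>_. c \<cdot>\<^sub>m \<tau>)" by (rule tensor_one_bdiag[OF p(2)])
    have "psd (2 ^ m * d) ?T"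
      unfolding T unfolding c_def by (intro psd_bdiag psd_smult p) auto
    note S = op_sqrt_psd[OF this]
    have "tr ?T = (\<Sum>i<2 ^ m :: nat. tr (c \<cdot>\<^sub>m \<tau>))"
      unfolding T using p by (intro tr_bdiag) auto
    also have "\<dots> = 1" unfolding c_def using p(3) tr_smult[OF p(2), of "1 / 2 ^ m"] by simp
    finally show ?thesis using trace_norm_upper_bound[OF R S(1)] unfolding S(2) F_def by simp
  qed
  have H_max: "H_max m d R = (SUP \<sigma> \<in> {\<sigma>. normalized_state d \<sigma>}. elog2 (2 ^ m * F \<sigma>))"
    by (simp add: H_max_def F_def c_def)
  have "H_max m d R \<le> elog2 (2 ^ m * (real (2 ^ m * d) * tr R))"
    unfolding H_max using F_le by (intro SUP_least elog2_mono mult_left_mono) auto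
  then have fin: "H_max m d R < \<infinity>" by (auto simp: elog2_def split: if_splits)
  have low: "elog2 (2 ^ m * F \<sigma>) \<le> H_max m d R"
    unfolding H_max using \<sigma> by (intro SUP_upper) auto
  have "F \<sigma> \<le> exp2 (H_max m d R - ereal (real m))"
  proof (cases "F \<sigma> \<le> 0")
    case True
    have "0 \<le> exp2 e" for e by (simp add: exp2_def)
    then show ?thesis using True by (rule order_trans[rotated])
  next
    case False
    then have "\<not> 2 ^ m * F \<sigma> \<le> 0" by (simp add: not_le)
    then have low': "ereal (log 2 (2 ^ m * F \<sigma>)) \<le> H_max m d R"
      using low unfolding elog2_def by (simp only: if_False)
    \<comment> \<open>\<open>low'\<close> excludes the value minus infinity and \<open>fin\<close>
      excludes infinity, so that \<open>exp2\<close> is a genuine power of 2 here.\<close>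
    then obtain h where h: "H_max m d R = ereal h" using fin by (cases "H_max m d R") auto
    have "F \<sigma> = 2 powr (log 2 (2 ^ m * F \<sigma>) - m)"
      using False by (simp add: powr_diff powr_realpow)
    also have "\<dots> \<le> 2 powr (h - m)" using low' h by simp
    finally show ?thesis by (simp add: h exp2_def)
  qed
  then show ?thesis by (simp add: F_def c_def)
qed

text \<open>As \<open>B\<close> is below \<open>S * S\<close>, the left side is at most
  \<open>tr (V * A * V * S * S)\<close>, where \<open>V\<close> and \<open>S\<close> cancel
  cyclically. With \<open>B\<close> the operator \<open>\<rho>E\<close>, the case
  \<open>A = \<rho>E\<close> bounds the spectrum at 0 and \<open>A = \<sigma>\<close> the sum of the
  whole spectrum.\<close>

lemma tr_sandwich_le:
  assumes A: "psd d A" and S: "S \<in> carrier_mat d d" and V: "psd d V" and SV: "S * V = 1\<^sub>m d" and VS: "V * S = 1\<^sub>m d"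
    and B: "B \<in> carrier_mat d d" and SS: "S * S = B + complex_of_real \<epsilon> \<cdot>\<^sub>m 1\<^sub>m d" and \<epsilon>: "0 < \<epsilon>"
  shows "tr (V * A * V * B) \<le> tr A"
proof -
  note k = S psd_carrier[OF V] psd_carrier[OF A]
  have "S * S - B = complex_of_real \<epsilon> \<cdot>\<^sub>m 1\<^sub>m d"
    unfolding SS using B by (intro eq_matI) auto
  then have "psd d (S * S - B)" using \<epsilon> by (simp add: psd_smult)
  moreover have "psd d (V * A * V)" using psd_congruence[OF A k(2)] psd_hermitian[OF V] by simp
  ultimately have "0 \<le> tr ((V * A * V) * (S * S - B))" by (intro tr_psd_mult_nonneg)
  also have "(V * A * V) * (S * S - B) = (V * A * V) * (S * S) - (V * A * V) * B"
    using k B by (intro mult_minus_distrib_mat[of _ d d] mult_carrier_mat[of _ d d])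
  also have "tr \<dots> = tr ((V * A * V) * (S * S)) - tr ((V * A * V) * B)"
    using k B by (intro tr_minus[of _ d] mult_carrier_mat[of _ d d])
  also have "(V * A * V) * (S * S) = V * A * ((V * S) * S)"
    using k by (simp add: assoc_mult_mat[of _ d d _ d _ d] mult_carrier_mat[of _ d d])
  also have "tr \<dots> = tr (S * (V * A))"
    unfolding VS using k by (subst tr_mult_comm[of _ d d]) auto
  also have "S * (V * A) = (S * V) * A" using k by simp
  also have "tr \<dots> = tr A" unfolding SV using k by simp
  finally show ?thesis by simp
qed

text \<open>Compare the hashed state with \<open>S\<^sup>2 = \<rho>\<^sub>E + \<epsilon> I\<close>, normalised, in place of the optimal \<open>\<sigma>\<close>. The
  spectrum at \<open>0\<close> contributes at most the trace.\<close>

lemma Q_PA_le_power_spectrum: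
  assumes d: "0 < d" and f: "f \<in> carrier_mat m n" and \<rho>: "\<And>z. z \<in> carrier_vec n \<Longrightarrow> psd d (\<rho> z)"
    and S: "psd d S" and V: "psd d V" and SV: "S * V = 1\<^sub>m d" and VS: "V * S = 1\<^sub>m d"
    and SS: "S * S = op_sum d \<rho> (carrier_vec n) + complex_of_real \<epsilon> \<cdot>\<^sub>m 1\<^sub>m d" and \<epsilon>: "0 < \<epsilon>"
  shows "Q_PA m n d \<rho> f \<le> \<epsilon> * d + (\<Sum>y\<in>carrier_vec m - {0\<^sub>v m}.
    power_spectrum n (\<lambda>z z'. tr (V * \<rho> z * V * \<rho> z')) (transpose_mat f *\<^sub>v y))"
proof -
  let ?b = "\<lambda>z z'. tr (V * \<rho> z * V * \<rho> z')"
  define \<rho>E where "\<rho>E = op_sum d \<rho> (carrier_vec n)"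
  define \<chi> where "\<chi> = (\<Sum>y\<in>carrier_vec m - {0\<^sub>v m}. power_spectrum n ?b (transpose_mat f *\<^sub>v y))"
  have c: "S \<in> carrier_mat d d" "V \<in> carrier_mat d d" using S V psd_carrier by auto
  have \<rho>c: "\<rho> z \<in> carrier_mat d d" if "z \<in> carrier_vec n" for z using \<rho>[OF that] psd_carrier by auto
  have pE: "psd d \<rho>E" unfolding \<rho>E_def using \<rho> by (intro psd_op_sum) auto
  have cE: "\<rho>E \<in> carrier_mat d d" using pE psd_carrier by auto
  define t where "t = tr \<rho>E"
  have t0: "0 \<le> t" unfolding t_def using pE by (rule tr_psd_nonneg)
  \<comment> \<open>The trace of \<open>S * S\<close>, by which the comparison operator is
    normalised.\<close>
  define t' where "t' = t + \<epsilon> * d"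
  have t': "0 < t'" "t \<le> t'" using t0 d \<epsilon> by (auto simp: t'_def add_nonneg_pos)
  have trSS: "tr (S * S) = t'"
    using cE by (simp add: SS \<rho>E_def[symmetric] t'_def t_def tr_add[of _ d] tr_smult[of _ d])
  have tr_n: "tr (cq_state n d \<rho>) = t"
    using \<rho>c by (simp add: tr_cq_state t_def \<rho>E_def tr_op_sum)
  define h where "h = hashed n d f \<rho>"
  have hp: "psd d (h k)" for k unfolding h_def hashed_def using \<rho> by (intro psd_op_sum) auto
  have hc: "h k \<in> carrier_mat d d" for k using hp psd_carrier by auto
  define R where "R = cq_state m d h"
  have R_bdiag: "R = bdiag (2 ^ m) d (\<lambda>i. h (bitvec m i))" unfolding R_def using hc by (intro cq_state_bdiag) auto
  have R: "psd (2 ^ m * d) R" unfolding R_bdiag using hp by (intro psd_bdiag) auto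
  have fC: "f *\<^sub>v z \<in> carrier_vec m" if "z \<in> carrier_vec n" for z using f that by simp
  have trR: "tr R = t"
  proof -
    have "tr R = (\<Sum>k\<in>carrier_vec m. tr (h k))" unfolding R_def using hc by (intro tr_cq_state) auto
    also have "\<dots> = (\<Sum>k\<in>carrier_vec m. \<Sum>z | z \<in> carrier_vec n \<and> f *\<^sub>v z = k. tr (\<rho> z))"
      unfolding h_def hashed_def using \<rho>c by (intro sum.cong refl tr_op_sum) auto
    also have "\<dots> = (\<Sum>z\<in>carrier_vec n. tr (\<rho> z))"
      using sum.group[of "carrier_vec n" "carrier_vec m" "\<lambda>z. f *\<^sub>v z" "\<lambda>z. tr (\<rho> z)"] fC by auto
    finally show ?thesis using \<rho>c by (simp add: t_def \<rho>E_def tr_op_sum)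
  qed
  \<comment> \<open>The collision term of the hashed state; its factor \<open>2 ^ m\<close> is that
    of the Poisson summation.\<close>
  define q where "q = 2 ^ m * (\<Sum>k\<in>carrier_vec m. tr (V * h k * V * h k))"
  have q_le: "q \<le> t + \<chi>"
  proof -
    have "q = 2 ^ m * (\<Sum>k\<in>carrier_vec m. \<Sum>z\<in>{z \<in> carrier_vec n. f *\<^sub>v z = k}.
        \<Sum>z'\<in>{z \<in> carrier_vec n. f *\<^sub>v z = k}. ?b z z')"
      unfolding q_def h_def hashed_def using \<rho>c c
      by (intro arg_cong[of _ _ "\<lambda>x. 2 ^ m * x"] sum.cong[OF refl] tr_sandwich_op_sum) auto
    also have "\<dots> = (\<Sum>y\<in>carrier_vec m. power_spectrum n ?b (transpose_mat f *\<^sub>v y))"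
      using sum_power_spectrum_row_space[OF f, of ?b] by simp
    also have "\<dots> = power_spectrum n ?b (transpose_mat f *\<^sub>v 0\<^sub>v m) + \<chi>"
      unfolding \<chi>_def by (subst sum.remove[of _ "0\<^sub>v m"]) auto
    also have "transpose_mat f *\<^sub>v 0\<^sub>v m = 0\<^sub>v n" using f by (intro eq_vecI) auto
    also have "power_spectrum n ?b (0\<^sub>v n) = tr (V * \<rho>E * V * \<rho>E)"
      unfolding \<rho>E_def using c \<rho>c by (intro power_spectrum_0) auto
    also have "\<dots> \<le> t"
      unfolding t_def using SS by (intro tr_sandwich_le[OF pE c(1) V SV VS cE _ \<epsilon>]) (simp add: \<rho>E_def)
    finally show ?thesis by simp
  qed
  define \<sigma> where "\<sigma> = complex_of_real (1 / t') \<cdot>\<^sub>m (S * S)"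
  have pSS: "psd d (S * S)" using psd_gram[OF c(1)] psd_hermitian[OF S] by simp
  have "psd d \<sigma>" unfolding \<sigma>_def using t' by (intro psd_smult pSS) auto
  moreover have "tr \<sigma> = 1 / t' * tr (S * S)" unfolding \<sigma>_def by (rule tr_smult[of _ d]) (use c in auto)
  ultimately have \<sigma>: "normalized_state d \<sigma>" using t' by (simp add: normalized_state_def trSS)
  \<comment> \<open>Chosen such that \<open>r * r\<close> times \<open>S * S\<close> is
    \<open>\<sigma>\<close> divided by \<open>2 ^ m\<close>; this makes \<open>T\<close> the root
    that occurs in \<open>H_max\<close>.\<close>
  define r where "r = 1 / sqrt (2 ^ m * t')"
  have r: "0 < r" "r * r = 1 / (2 ^ m * t')" using t' by (auto simp: r_def)
  define T where "T = bdiag (2 ^ m) d (\<lambda>_. complex_of_real r \<cdot>\<^sub>m S)"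
  define W where "W = bdiag (2 ^ m) d (\<lambda>_. complex_of_real (1 / r) \<cdot>\<^sub>m V)"
  have T: "psd (2 ^ m * d) T" unfolding T_def using S r by (intro psd_bdiag psd_smult) auto
  have W: "psd (2 ^ m * d) W" unfolding W_def using V r by (intro psd_bdiag psd_smult) auto
  have "(complex_of_real r \<cdot>\<^sub>m S) * (complex_of_real (1 / r) \<cdot>\<^sub>m V) = 1\<^sub>m d"
    "(complex_of_real (1 / r) \<cdot>\<^sub>m V) * (complex_of_real r \<cdot>\<^sub>m S) = 1\<^sub>m d"
    using c SV VS r by (auto simp: mult_smult_distrib[of _ d d _ d] mult_smult_assoc_mat[of _ d d _ d] smult_smult_mat)
  then have TW: "T * W = 1\<^sub>m (2 ^ m * d)" "W * T = 1\<^sub>m (2 ^ m * d)"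
    unfolding T_def W_def using c by (simp_all add: bdiag_mult bdiag_one)
  have TT: "op_sqrt (tensor_op (complex_of_real (1 / 2 ^ m) \<cdot>\<^sub>m 1\<^sub>m (2 ^ m)) \<sigma>) = T"
  proof (rule op_sqrt_eqI[OF T])
    have "T * T = bdiag (2 ^ m) d (\<lambda>_. complex_of_real (r * r) \<cdot>\<^sub>m (S * S))"
      unfolding T_def using c
      by (simp add: bdiag_mult mult_smult_distrib[of _ d d _ d] mult_smult_assoc_mat[of _ d d _ d] smult_smult_mat)
    also have "\<dots> = tensor_op (complex_of_real (1 / 2 ^ m) \<cdot>\<^sub>m 1\<^sub>m (2 ^ m)) \<sigma>"
      using c unfolding \<sigma>_def r(2) by (subst tensor_one_bdiag[of _ d]) (auto simp: smult_smult_mat)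
    finally show "T * T = tensor_op (complex_of_real (1 / 2 ^ m) \<cdot>\<^sub>m 1\<^sub>m (2 ^ m)) \<sigma>" .
  qed
  have trWRWR: "tr (W * R * W * R) = t' * q"
  proof -
    have "W * R * W * R = bdiag (2 ^ m) d (\<lambda>i. complex_of_real (1 / (r * r)) \<cdot>\<^sub>m (V * h (bitvec m i) * V * h (bitvec m i)))"
      unfolding W_def R_bdiag using c hc
      by (simp add: bdiag_mult mult_smult_distrib[of _ d d _ d] mult_smult_assoc_mat[of _ d d _ d] smult_smult_mat
          mult_carrier_mat[of _ d d])
    also have "tr \<dots> = (\<Sum>i<2 ^ m. tr (complex_of_real (1 / (r * r)) \<cdot>\<^sub>m (V * h (bitvec m i) * V * h (bitvec m i))))"
      using c hc by (intro tr_bdiag smult_carrier_mat mult_carrier_mat[of _ d d])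
    also have "\<dots> = (\<Sum>i<2 ^ m. 1 / (r * r) * tr (V * h (bitvec m i) * V * h (bitvec m i)))"
      using c hc by (intro sum.cong[OF refl] tr_smult[of _ d] mult_carrier_mat[of _ d d])
    also have "\<dots> = (\<Sum>k\<in>carrier_vec m. 1 / (r * r) * tr (V * h k * V * h k))"
      by (rule sum.reindex_bij_betw[OF bij_betw_bitvec])
    also have "\<dots> = t' * q" unfolding r(2) q_def by (simp add: sum_distrib_left mult_ac)
    finally show ?thesis .
  qed
  define F where "F = trace_norm (op_sqrt R * T)"
  \<comment> \<open>With this scale the rescaled \<open>R\<close> has trace \<open>t / t'\<close>,
    close to the trace 1 of \<open>T * T\<close>.\<close>
  have "3 * (1 / sqrt t')\<^sup>2 * tr R \<le> 2 * (1 / sqrt t') * F + (1 / sqrt t') ^ 4 * tr (W * R * W * R)"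
    unfolding F_def using R T W TW t' by (intro trace_norm_lower_bound) auto
  moreover have "(1 / sqrt t')\<^sup>2 = 1 / t'" "(1 / sqrt t') ^ 4 = 1 / t'\<^sup>2"
    using t' by (auto simp: power_divide power4_eq_xxxx power2_eq_square)
  ultimately have "3 * t / t' \<le> 2 * F / sqrt t' + q / t'"
    unfolding trR trWRWR using t' by (simp add: power2_eq_square)
  then have "t' * (3 * t / t') \<le> t' * (2 * F / sqrt t' + q / t')" using t' by (intro mult_left_mono) auto
  moreover have "t' * (2 * F / sqrt t') = 2 * F * (t' / sqrt t')" by simp
  ultimately have "3 * t \<le> 2 * F * sqrt t' + q" using t' by (simp add: distrib_left real_div_sqrt)
  then have F_low: "t - \<chi> / 2 \<le> F * sqrt t'" using q_le by simp
  have "F\<^sup>2 \<le> exp2 (H_max m d R - ereal (real m))"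
    using exp2_H_max_ge[OF R \<sigma>] unfolding TT F_def .
  then have Q: "Q_PA m n d \<rho> f \<le> t - F\<^sup>2"
    by (simp add: Q_PA_def tr_n R_def h_def)
  have \<chi>0: "0 \<le> \<chi>" unfolding \<chi>_def using V \<rho> by (intro sum_nonneg power_spectrum_nonneg) auto
  have "t - F\<^sup>2 \<le> \<epsilon> * d + \<chi>"
  \<comment> \<open>If \<open>t\<close> exceeds \<open>\<chi>\<close>, then
    \<open>t - \<chi> / 2\<close> is positive and its lower bound on \<open>F * sqrt t'\<close> may
    be squared; otherwise \<open>F\<^sup>2 \<ge> 0\<close> suffices.\<close>
  proof (cases "t \<le> \<chi>")
    case True
    have "0 \<le> \<epsilon> * d" using \<epsilon> by simp
    then show ?thesis using True zero_le_power2[of F] by linarith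
  next
    case False
    then have "(t - \<chi> / 2)\<^sup>2 \<le> (F * sqrt t')\<^sup>2" using F_low \<chi>0 by (intro power_mono) auto
    then have "(t - \<chi> / 2)\<^sup>2 \<le> F\<^sup>2 * t'" using t' by (simp add: power_mult_distrib)
    moreover have "(t - \<chi> / 2)\<^sup>2 = t\<^sup>2 - t * \<chi> + (\<chi> / 2)\<^sup>2" by (simp add: power2_eq_square field_simps)
    ultimately have "t\<^sup>2 - t * \<chi> \<le> F\<^sup>2 * t'" using zero_le_power2[of "\<chi> / 2"] by linarith
    \<comment> \<open>The claim times \<open>t'\<close>: inserting
      \<open>t' = t + \<epsilon> * d\<close> into \<open>t * t' - F\<^sup>2 * t'\<close> cancels
      \<open>t\<^sup>2\<close>.\<close>
    then have "(t - F\<^sup>2) * t' \<le> t * (\<epsilon> * d + \<chi>)" by (simp add: t'_def power2_eq_square algebra_simps)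
    also have "\<dots> \<le> t' * (\<epsilon> * d + \<chi>)" using t' \<chi>0 \<epsilon> by (intro mult_right_mono) auto
    finally show ?thesis using t' by (simp add: mult.commute)
  qed
  then show ?thesis using Q unfolding \<chi>_def by linarith
qed

section \<open>Averaging over the hash functions\<close>

text \<open>Makes the support of a random function finite, so that expectations are finite
  sums.\<close>

lemma finite_bit_mats: "finite (carrier_mat m n :: bit mat set)"
proof -
  have "(UNIV :: bit set) = {0, 1}" using bit_not_zero_iff by auto
  then have fin: "finite (UNIV :: bit set)" by (metis finite.emptyI finite.insertI)
  let ?D = "{..<m} \<times> {..<n}"
  have "(carrier_mat m n :: bit mat set) \<subseteq> (\<lambda>g. mat m n g) ` (?D \<rightarrow>\<^sub>E UNIV)"
  proof
    fix M :: "bit mat" assume M: "M \<in> carrier_mat m n"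
    define g where "g = restrict (\<lambda>ij. M $$ ij) ?D"
    have "M = mat m n g"
      by (rule eq_matI) (use M in \<open>auto simp: g_def\<close>)
    moreover have "g \<in> ?D \<rightarrow>\<^sub>E UNIV" by (simp add: g_def)
    ultimately show "M \<in> (\<lambda>g. mat m n g) ` (?D \<rightarrow>\<^sub>E UNIV)" by (rule image_eqI[of _ "mat m n"])
  qed
  then show ?thesis by (rule finite_subset) (intro finite_imageI finite_PiE finite_cartesian_product finite_lessThan fin)
qed

text \<open>The pairing \<open>h\<close> preserves weights. The left side is the form in which the
  probability appears once the average over \<open>f\<close> is moved inside the sum over
  \<open>x\<close>.\<close>

lemma prob_dual_random:
  assumes bij: "bij_betw h (set_pmf F) (set_pmf G)" and eq: "\<And>f. f \<in> set_pmf F \<Longrightarrow> pmf F f = pmf G (h f)"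
    and fin: "finite (set_pmf F)"
  shows "(\<Sum>f\<in>set_pmf F. if P (h f) then pmf F f else 0) = measure_pmf.prob G {g. P g}"
proof -
  have finG: "finite (set_pmf G)" using bij fin bij_betw_finite by blast
  have "(\<Sum>f\<in>set_pmf F. if P (h f) then pmf F f else 0) = (\<Sum>f\<in>set_pmf F. if P (h f) then pmf G (h f) else 0)"
    by (intro sum.cong) (auto simp: eq)
  also have "\<dots> = (\<Sum>g\<in>set_pmf G. if P g then pmf G g else 0)"
    by (rule sum.reindex_bij_betw[OF bij])
  also have "\<dots> = (\<Sum>g\<in>{g \<in> set_pmf G. P g}. pmf G g)"
    using finG by (simp add: sum.inter_filter)
  also have "\<dots> = measure_pmf.prob G {g \<in> set_pmf G. P g}"
    using finG by (subst measure_measure_pmf_finite) auto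
  also have "{g \<in> set_pmf G. P g} = {g. P g} \<inter> set_pmf G" by auto
  also have "measure_pmf.prob G \<dots> = measure_pmf.prob G {g. P g}"
    by (rule measure_Int_set_pmf)
  finally show ?thesis .
qed

text \<open>\<open>S\<close> and \<open>V\<close> depend on \<open>\<rho>\<close> and
  \<open>\<epsilon>\<close> only, hence \<open>c\<close> is the same for all hash functions and
  averaging affects nothing but the condition \<open>h f *\<^sub>v x = 0\<^sub>v (n - m)\<close>.
  The term \<open>\<epsilon> * d\<close> is the trace added by the shift.\<close>

lemma expectation_Q_PA_le:
  assumes mn: "m \<le> n" and d: "0 < d" and \<delta>: "0 \<le> \<delta>"
    and F: "almost_dual_universal2 m n \<delta> F"
    and \<rho>: "\<And>z. z \<in> carrier_vec n \<Longrightarrow> psd d (\<rho> z)"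
    and \<sigma>: "psd d \<sigma>" "\<And>z. z \<in> carrier_vec n \<Longrightarrow> psd d (\<sigma> - \<rho> z)"
    and \<epsilon>: "0 < \<epsilon>"
  shows "measure_pmf.expectation F (\<lambda>f. Q_PA m n d \<rho> f) \<le> \<epsilon> * d + 2 ^ m * tr \<sigma> * \<delta>"
proof -
  obtain G h where bij: "bij_betw h (set_pmf F) (set_pmf G)"
    and dual: "\<And>f. f \<in> set_pmf F \<Longrightarrow> dual_fun m n f (h f)"
    and eq: "\<And>f. f \<in> set_pmf F \<Longrightarrow> pmf F f = pmf G (h f)"
    and G: "\<And>x. x \<in> carrier_vec n \<Longrightarrow> x \<noteq> 0\<^sub>v n \<Longrightarrow>
      measure_pmf.prob G {g. g *\<^sub>v x = 0\<^sub>v (n - m)} \<le> 2 powr (- real (n - m)) * \<delta>"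
    using F unfolding almost_dual_universal2_def dual_random_def almost_universal2_def by blast
  have fc: "f \<in> carrier_mat m n" if "f \<in> set_pmf F" for f
    using dual[OF that] by (auto simp: dual_fun_def linear_surj_def)
  then have fin: "finite (set_pmf F)" by (intro finite_subset[OF _ finite_bit_mats[of m n]]) auto
  have \<rho>c: "\<rho> z \<in> carrier_mat d d" if "z \<in> carrier_vec n" for z using \<rho>[OF that] psd_carrier by auto
  have \<sigma>c: "\<sigma> \<in> carrier_mat d d" using \<sigma> psd_carrier by auto
  define \<rho>E where "\<rho>E = op_sum d \<rho> (carrier_vec n)"
  have pE: "psd d \<rho>E" unfolding \<rho>E_def using \<rho> by (intro psd_op_sum) auto
  have cE: "\<rho>E \<in> carrier_mat d d" using pE psd_carrier by auto
  obtain S V where SV: "psd d S" "psd d V" "S * S = \<rho>E + complex_of_real \<epsilon> \<cdot>\<^sub>m 1\<^sub>m d" "S * V = 1\<^sub>m d" "V * S = 1\<^sub>m d"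
    using psd_shifted_sqrt[OF pE \<epsilon>] by blast
  note k = psd_carrier[OF SV(1)] psd_carrier[OF SV(2)]
  define c where "c = power_spectrum n (\<lambda>z z'. tr (V * \<rho> z * V * \<rho> z'))"
  have c0: "0 \<le> c x" for x unfolding c_def using SV(2) \<rho> by (rule power_spectrum_nonneg)
  let ?K = "carrier_vec n - {0\<^sub>v n} :: bit vec set"
  have Q: "Q_PA m n d \<rho> f \<le> \<epsilon> * d + (\<Sum>x\<in>?K. if h f *\<^sub>v x = 0\<^sub>v (n - m) then c x else 0)"
    if f: "f \<in> set_pmf F" for f
  proof -
    have "Q_PA m n d \<rho> f \<le> \<epsilon> * d + (\<Sum>y\<in>carrier_vec m - {0\<^sub>v m}. c (transpose_mat f *\<^sub>v y))"
      unfolding c_def using d fc[OF f] \<rho> SV \<epsilon> by (intro Q_PA_le_power_spectrum) (auto simp: \<rho>E_def)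
    then show ?thesis using sum_row_space_le[OF dual[OF f], of c] c0 by force
  qed
  have sum_c: "(\<Sum>x\<in>carrier_vec n. c x) \<le> 2 ^ n * tr \<sigma>"
  proof -
    \<comment> \<open>Replacing one of the two factors \<open>\<rho> z\<close> makes the summand
      linear in \<open>\<rho> z\<close>, so that the sum over \<open>z\<close> collapses to
      \<open>\<rho>E\<close>.\<close>
    have le1: "tr (V * \<rho> z * V * \<rho> z) \<le> tr (V * \<sigma> * V * \<rho> z)" if z: "z \<in> carrier_vec n" for z
    proof -
      have "psd d (V * \<rho> z * V)" using psd_congruence[OF \<rho>[OF z] k(2)] psd_hermitian[OF SV(2)] by simp
      then have "0 \<le> tr ((V * \<rho> z * V) * (\<sigma> - \<rho> z))" using \<sigma>(2)[OF z] by (rule tr_psd_mult_nonneg)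
      also have "(V * \<rho> z * V) * (\<sigma> - \<rho> z) = (V * \<rho> z * V) * \<sigma> - (V * \<rho> z * V) * \<rho> z"
        using k \<rho>c[OF z] \<sigma>c by (intro mult_minus_distrib_mat[of _ d d] mult_carrier_mat[of _ d d])
      also have "tr \<dots> = tr ((V * \<rho> z * V) * \<sigma>) - tr ((V * \<rho> z * V) * \<rho> z)"
        using k \<rho>c[OF z] \<sigma>c by (intro tr_minus[of _ d] mult_carrier_mat[of _ d d])
      also have "tr ((V * \<rho> z * V) * \<sigma>) = tr (V * \<sigma> * V * \<rho> z)"
        using k \<rho>c[OF z] \<sigma>c tr_mult_comm[of "V * \<rho> z" d d "V * \<sigma>"] by (simp add: assoc_mult_mat[of _ d d _ d _ d])
      finally show ?thesis by simp
    qed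
    have "(\<Sum>x\<in>carrier_vec n. c x) = 2 ^ n * (\<Sum>z\<in>carrier_vec n. tr (V * \<rho> z * V * \<rho> z))"
      unfolding c_def by (rule sum_power_spectrum)
    also have "\<dots> \<le> 2 ^ n * (\<Sum>z\<in>carrier_vec n. tr (V * \<sigma> * V * \<rho> z))"
      using le1 by (intro mult_left_mono sum_mono) auto
    also have "(\<Sum>z\<in>carrier_vec n. tr (V * \<sigma> * V * \<rho> z)) = tr (V * \<sigma> * V * \<rho>E)"
      unfolding \<rho>E_def using k \<sigma>c \<rho>c by (intro tr_mult_op_sum[symmetric] mult_carrier_mat[of _ d d]) auto
    also have "\<dots> \<le> tr \<sigma>"
      by (rule tr_sandwich_le[OF \<sigma>(1) k(1) SV(2,4,5) cE SV(3) \<epsilon>])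
    finally show ?thesis by simp
  qed
  have "measure_pmf.expectation F (\<lambda>f. Q_PA m n d \<rho> f) = (\<Sum>f\<in>set_pmf F. Q_PA m n d \<rho> f * pmf F f)"
    using fin by (intro integral_measure_pmf_real) auto
  also have "\<dots> \<le> (\<Sum>f\<in>set_pmf F. (\<epsilon> * d + (\<Sum>x\<in>?K. if h f *\<^sub>v x = 0\<^sub>v (n - m) then c x else 0)) * pmf F f)"
    using Q by (intro sum_mono mult_right_mono) auto
  also have "\<dots> = \<epsilon> * d * (\<Sum>f\<in>set_pmf F. pmf F f)
      + (\<Sum>f\<in>set_pmf F. \<Sum>x\<in>?K. c x * (if h f *\<^sub>v x = 0\<^sub>v (n - m) then pmf F f else 0))"
    by (simp add: distrib_right sum.distrib sum_distrib_left sum_distrib_right if_distrib if_distribR cong: if_cong)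
  also have "(\<Sum>f\<in>set_pmf F. pmf F f) = 1" using fin by (intro sum_pmf_eq_1) auto
  also have "(\<Sum>f\<in>set_pmf F. \<Sum>x\<in>?K. c x * (if h f *\<^sub>v x = 0\<^sub>v (n - m) then pmf F f else 0))
      = (\<Sum>x\<in>?K. \<Sum>f\<in>set_pmf F. c x * (if h f *\<^sub>v x = 0\<^sub>v (n - m) then pmf F f else 0))"
    by (rule sum.swap)
  also have "\<dots> = (\<Sum>x\<in>?K. c x * measure_pmf.prob G {g. g *\<^sub>v x = 0\<^sub>v (n - m)})"
    unfolding sum_distrib_left[symmetric]
    by (intro sum.cong[OF refl] arg_cong2[of _ _ _ _ "(*)"] refl prob_dual_random[OF bij eq fin])
  also have "\<dots> \<le> (\<Sum>x\<in>?K. c x * (2 powr (- real (n - m)) * \<delta>))"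
    using G c0 by (intro sum_mono mult_left_mono) auto
  also have "\<dots> = (\<Sum>x\<in>?K. c x) * (2 powr (- real (n - m)) * \<delta>)"
    by (rule sum_distrib_right[symmetric])
  \<comment> \<open>The term at 0 is put back, at no cost as it is nonnegative, to apply the bound
    on the full spectrum.\<close>
  also have "\<dots> \<le> (\<Sum>x\<in>carrier_vec n. c x) * (2 powr (- real (n - m)) * \<delta>)"
    using c0 \<delta> by (intro mult_right_mono sum_mono2) auto
  also have "\<dots> \<le> 2 ^ n * tr \<sigma> * (2 powr (- real (n - m)) * \<delta>)"
    using sum_c \<delta> by (intro mult_right_mono) auto
  also have "\<dots> = (2 ^ n * 2 powr (- real (n - m))) * tr \<sigma> * \<delta>" by simp
  also have "2 ^ n * 2 powr (- real (n - m)) = (2 ^ m :: real)"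
    using mn by (simp add: powr_realpow[symmetric] powr_add[symmetric] of_nat_diff)
  finally show ?thesis by simp
qed

text \<open>If the infimum is 0, \<open>H_min\<close> is infinite and the value 0 of
  \<open>exp2\<close> at minus infinity keeps the formula true. The sum of all
  \<open>\<rho> z\<close> is feasible, since subtracting one of them leaves the sum of the
  others.\<close>

lemma exp2_minus_H_min:
  assumes "\<And>z. z \<in> carrier_vec n \<Longrightarrow> psd d (\<rho> z)"
  defines "A \<equiv> tr ` {\<sigma>. psd d \<sigma> \<and> (\<forall>z\<in>carrier_vec n. psd d (\<sigma> - \<rho> z))}"
  shows "exp2 (ereal (real m) - H_min n d (cq_state n d \<rho>)) = 2 ^ m * Inf A" "A \<noteq> {}" "0 \<le> Inf A"
proof -
  have c: "\<rho> z \<in> carrier_mat d d" if "z \<in> carrier_vec n" for z using assms(1)[OF that] psd_carrier by auto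
  have "psd d (op_sum d \<rho> (carrier_vec n) - \<rho> z)" if z: "z \<in> carrier_vec n" for z
  proof -
    have "op_sum d \<rho> (carrier_vec n) - \<rho> z = op_sum d \<rho> (carrier_vec n - {z})"
      by (rule eq_matI) (use c[OF z] z in \<open>auto simp: op_sum_def sum_diff1\<close>)
    then show ?thesis using assms(1) by (auto intro!: psd_op_sum)
  qed
  moreover have "psd d (op_sum d \<rho> (carrier_vec n))" using assms(1) by (intro psd_op_sum) auto
  ultimately show ne: "A \<noteq> {}" by (auto simp: A_def)
  show Inf0: "0 \<le> Inf A" using ne by (rule cInf_greatest) (auto simp: A_def tr_psd_nonneg)
  have "{\<sigma>. psd d \<sigma> \<and> loewner_le (2 ^ n * d) (cq_state n d \<rho>) (tensor_op (1\<^sub>m (2 ^ n)) \<sigma>)}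
      = {\<sigma>. psd d \<sigma> \<and> (\<forall>z\<in>carrier_vec n. psd d (\<sigma> - \<rho> z))}"
    using loewner_le_cq_state_iff[of n \<rho> d] c psd_carrier by blast
  then have H: "H_min n d (cq_state n d \<rho>) = - elog2 (Inf A)" by (simp add: H_min_def A_def)
  show "exp2 (ereal (real m) - H_min n d (cq_state n d \<rho>)) = 2 ^ m * Inf A"
  proof (cases "Inf A = 0")
    case True
    then show ?thesis by (simp add: H elog2_def exp2_def)
  next
    case False
    then have "0 < Inf A" using Inf0 by simp
    then show ?thesis by (simp add: H elog2_def exp2_def powr_add powr_realpow)
  qed
qed

text \<open>For \<open>n = 0\<close> there is no nonzero \<open>x\<close>, so universality would
  admit a negative \<open>\<delta>\<close>. Hashing is then trivial and the index is 0, while the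
  right side would be negative for a nonzero state; hence the sign condition in this case.\<close>

theorem lemma8:
  fixes m n d :: nat and \<delta> :: real
    and F :: "bit mat pmf" and \<rho> :: "bit vec \<Rightarrow> complex mat"
  assumes "m \<le> n"
    and "0 < d"
    and "n = 0 \<Longrightarrow> 0 \<le> \<delta>"
    and "almost_dual_universal2 m n \<delta> F"
    and "\<And>z. z \<in> carrier_vec n \<Longrightarrow> \<rho> z \<in> carrier_mat d d"
    and "subnormalized_state (2 ^ n * d) (cq_state n d \<rho>)"
  shows "measure_pmf.expectation F (\<lambda>f. Q_PA m n d \<rho> f)
    \<le> exp2 (ereal (real m) - H_min n d (cq_state n d \<rho>)) * \<delta>"
proof -
  have \<rho>: "psd d (\<rho> z)" if "z \<in> carrier_vec n" for z
    using assms(6) psd_cq_state_iff[of n \<rho> d, OF assms(5)] that by (auto simp: subnormalized_state_def)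
  have \<delta>: "0 \<le> \<delta>"
  proof (cases "n = 0")
    case False
    \<comment> \<open>Any nonzero vector does: a probability bounded by a positive multiple of
      \<open>\<delta>\<close> forces \<open>0 \<le> \<delta>\<close>.\<close>
    define x :: "bit vec" where "x = unit_vec n 0"
    have x: "x \<in> carrier_vec n" "x \<noteq> 0\<^sub>v n"
      using False by (auto simp: x_def vec_eq_iff intro!: exI[of _ 0])
    obtain G where "measure_pmf.prob G {g. g *\<^sub>v x = 0\<^sub>v (n - m)} \<le> 2 powr (- real (n - m)) * \<delta>"
      using assms(4) x unfolding almost_dual_universal2_def almost_universal2_def by blast
    then have "0 \<le> 2 powr (- real (n - m)) * \<delta>" by (rule order_trans[OF measure_nonneg])
    then show ?thesis by (simp add: zero_le_mult_iff)
  qed (use assms(3) in simp)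
  define E where "E = measure_pmf.expectation F (\<lambda>f. Q_PA m n d \<rho> f)"
  define A where "A = tr ` {\<sigma>. psd d \<sigma> \<and> (\<forall>z\<in>carrier_vec n. psd d (\<sigma> - \<rho> z))}"
  have A: "exp2 (ereal (real m) - H_min n d (cq_state n d \<rho>)) = 2 ^ m * Inf A"
    unfolding A_def using \<rho> by (rule exp2_minus_H_min(1))
  have ne: "A \<noteq> {}"
    unfolding A_def using \<rho> by (rule exp2_minus_H_min(2))
  have bound: "E \<le> 2 ^ m * s * \<delta>" if s: "s \<in> A" for s
  proof (rule field_le_epsilon)
    fix e :: real assume "0 < e"
    obtain \<sigma> where \<sigma>: "psd d \<sigma>" "\<And>z. z \<in> carrier_vec n \<Longrightarrow> psd d (\<sigma> - \<rho> z)" "s = tr \<sigma>"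
      using s unfolding A_def by blast
    \<comment> \<open>The shift is taken as \<open>e / d\<close>, so that its total trace is
      \<open>e\<close>.\<close>
    have "E \<le> e / d * d + 2 ^ m * tr \<sigma> * \<delta>"
      unfolding E_def using assms(1,2,4) \<delta> \<rho> \<sigma> \<open>0 < e\<close> by (intro expectation_Q_PA_le) auto
    then show "E \<le> 2 ^ m * s * \<delta> + e" using assms(2) \<sigma>(3) by simp
  qed
  have "E \<le> 2 ^ m * Inf A * \<delta>"
  \<comment> \<open>Passing to the infimum divides by \<open>\<delta>\<close>; for
    \<open>\<delta> = 0\<close> any single element of \<open>A\<close> gives the bound.\<close>
  proof (cases "\<delta> = 0")
    case True
    then show ?thesis using bound ne by auto
  next
    case False
    then have pos: "0 < 2 ^ m * \<delta>" using \<delta> by simp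
    have "E / (2 ^ m * \<delta>) \<le> Inf A"
      using ne bound pos by (intro cInf_greatest) (auto simp: divide_le_eq mult_ac)
    then show ?thesis using pos by (simp add: divide_le_eq mult_ac)
  qed
  then show ?thesis unfolding A E_def .
qed

end
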